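(* Let $G$ be a hereditarily $h$-complete topological group. Then every continuous homomorphism $f: G \rightarrow H$ onto a metrizable topological group $H$ is open.
   Context: All topological groups are assumed to be Hausdorff. A topological group $G$ is $h$-complete if for every continuous homomorphism $\varphi: G \rightarrow L$ into a topological group $L$, the image $\varphi(G)$ is closed in $L$. $G$ is hereditarily $h$-complete if every closed subgroup of $G$ is $h$-complete. *)

theory Defs
  imports "HOL-Analysis.Analysis" "HOL-Algebra.Coset"
begin

(* All topological groups are Hausdorff. *)
locale topological_group = group G for G (structure) and T +
  assumes topspace_eq: "topspace T = carrier G"
    and continuous_mult: "continuous_map (prod_topology T T) T (\<lambda>(x, y). x \<otimes> y)"
    and continuous_inv: "continuous_map T T (\<lambda>x. inv x)"
    and Hausdorff: "Hausdorff_space T"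

(* HOL cannot quantify over all types inside a definition, so the target groups L range over
   the groups whose elements have type 'a set set.  This loses no generality: the lemma
   h_complete_closed_image below gives the same property for targets over an arbitrary type
   'b, since the closure of the image of G in a Hausdorff group has at most
   2 ^ (2 ^ card G) elements. *)
definition h_complete :: "('a, 'm) monoid_scheme \<Rightarrow> 'a topology \<Rightarrow> bool" where
  "h_complete G T \<longleftrightarrow>
    (\<forall>(L :: 'a set set monoid) TL \<phi>.
       topological_group L TL \<longrightarrow> \<phi> \<in> hom G L \<longrightarrow> continuous_map T TL \<phi> \<longrightarrow>
       closedin TL (\<phi> ` carrier G))"

definition hereditarily_h_complete :: "('a, 'm) monoid_scheme \<Rightarrow> 'a topology \<Rightarrow> bool" where
  "hereditarily_h_complete G T \<longleftrightarrow>
    (\<forall>K. subgroup K G \<longrightarrow> closedin T K \<longrightarrow>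
       h_complete (G\<lparr>carrier := K\<rparr>) (subtopology T K))"

context topological_group
begin

lemma subgroup_closure_of:
  assumes "subgroup K G"
  shows "subgroup (T closure_of K) G"
proof -
  have K: "K \<subseteq> topspace T"
    using assms subgroup.subset topspace_eq by blast
  show ?thesis
  proof (rule subgroupI)
    show "T closure_of K \<subseteq> carrier G"
      using closure_of_subset_topspace topspace_eq by metis
    show "T closure_of K \<noteq> {}"
      using closure_of_subset[OF K] subgroup.one_closed[OF assms] by blast
  next
    fix a assume "a \<in> T closure_of K"
    then have "inv a \<in> T closure_of ((\<lambda>x. inv x) ` K)"
      using continuous_map_image_closure_subset[OF continuous_inv, of K] by blast
    moreover have "(\<lambda>x. inv x) ` K \<subseteq> K"
      using subgroup.m_inv_closed[OF assms] by blast
    ultimately show "inv a \<in> T closure_of K"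
      using closure_of_mono by blast
  next
    fix a b assume "a \<in> T closure_of K" "b \<in> T closure_of K"
    then have "(a, b) \<in> prod_topology T T closure_of (K \<times> K)"
      by (simp add: closure_of_Times)
    then have "a \<otimes> b \<in> T closure_of ((\<lambda>(x, y). x \<otimes> y) ` (K \<times> K))"
      using continuous_map_image_closure_subset[OF continuous_mult, of "K \<times> K"] by force
    moreover have "(\<lambda>(x, y). x \<otimes> y) ` (K \<times> K) \<subseteq> K"
      using subgroup.m_closed[OF assms] by auto
    ultimately show "a \<otimes> b \<in> T closure_of K"
      using closure_of_mono by blast
  qed
qed

lemma topological_group_transport:
  assumes C: "subgroup C G" and j: "inj_on j C"
  defines "i \<equiv> inv_into C j"
  shows "topological_group
    \<lparr>carrier = j ` C, mult = \<lambda>a b. j (i a \<otimes> i b), one = j \<one>\<rparr> (pullback_topology (j ` C) i T)"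
    (is "topological_group ?L ?T")
proof -
  have CG: "C \<subseteq> carrier G"
    by (rule subgroup.subset[OF C])
  have ij: "i (j x) = x" if "x \<in> C" for x
    using that j by (simp add: i_def)
  have iC: "i a \<in> C" if "a \<in> j ` C" for a
    using that ij by auto
  have top: "topspace ?T = j ` C"
    using iC CG topspace_eq by (auto simp: topspace_pullback_topology)
  have i_cont: "continuous_map ?T T i"
    using continuous_map_pullback[of T T id "j ` C" i] by (simp add: o_def id_def)
  have grp: "group ?L"
  proof (rule groupI)
    fix x assume "x \<in> carrier ?L"
    then obtain c where c: "c \<in> C" "x = j c" by auto
    then have "j (inv c) \<in> carrier ?L" "j (inv c) \<otimes>\<^bsub>?L\<^esub> x = \<one>\<^bsub>?L\<^esub>"
      using CG subgroup.m_inv_closed[OF C] by (auto simp: ij)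
    then show "\<exists>y \<in> carrier ?L. y \<otimes>\<^bsub>?L\<^esub> x = \<one>\<^bsub>?L\<^esub>" by blast
  qed (use CG subgroup.m_closed[OF C] subgroup.one_closed[OF C] in
        \<open>auto simp: ij m_assoc subset_iff\<close>)
  have inv_eq: "inv\<^bsub>?L\<^esub> a = j (inv (i a))" if "a \<in> j ` C" for a
  proof (rule group.inv_equality[OF grp])
    show "j (inv (i a)) \<otimes>\<^bsub>?L\<^esub> a = \<one>\<^bsub>?L\<^esub>" "a \<in> carrier ?L" "j (inv (i a)) \<in> carrier ?L"
      using that iC[OF that] CG subgroup.m_inv_closed[OF C] by (auto simp: ij)
  qed
  have "continuous_map ?T ?T (\<lambda>a. j (inv (i a)))"
  proof (rule continuous_map_pullback')
    have "continuous_map ?T T (\<lambda>a. inv (i a))"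
      using continuous_map_compose[OF i_cont continuous_inv] by (simp add: o_def)
    then show "continuous_map ?T T (i \<circ> (\<lambda>a. j (inv (i a))))"
      by (rule continuous_map_eq) (use top iC ij subgroup.m_inv_closed[OF C] in auto)
    show "topspace ?T \<subseteq> (\<lambda>a. j (inv (i a))) -` (j ` C)"
      using top iC subgroup.m_inv_closed[OF C] by auto
  qed
  then have inv_cont: "continuous_map ?T ?T (\<lambda>a. inv\<^bsub>?L\<^esub> a)"
    by (rule continuous_map_eq) (use top inv_eq in auto)
  have mult_cont: "continuous_map (prod_topology ?T ?T) ?T (\<lambda>(a, b). a \<otimes>\<^bsub>?L\<^esub> b)"
  proof (rule continuous_map_pullback')
    have "continuous_map (prod_topology ?T ?T) (prod_topology T T) (\<lambda>(a, b). (i a, i b))"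
      using i_cont by (simp add: continuous_map_prod_top)
    from continuous_map_compose[OF this continuous_mult]
    have "continuous_map (prod_topology ?T ?T) T (\<lambda>(a, b). i a \<otimes> i b)"
      by (simp add: o_def case_prod_unfold)
    then show "continuous_map (prod_topology ?T ?T) T (i \<circ> (\<lambda>(a, b). a \<otimes>\<^bsub>?L\<^esub> b))"
      by (rule continuous_map_eq) (use top iC ij subgroup.m_closed[OF C] in auto)
    show "topspace (prod_topology ?T ?T) \<subseteq> (\<lambda>(a, b). a \<otimes>\<^bsub>?L\<^esub> b) -` (j ` C)"
      using top iC subgroup.m_closed[OF C] by auto
  qed
  have "inj_on i (topspace ?T)"
    using top ij by (auto intro!: inj_onI)
  then have "Hausdorff_space ?T"
    using Hausdorff_space_injective_preimage[OF Hausdorff i_cont] by blast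
  then show ?thesis
    using grp top inv_cont mult_cont
    by (auto simp: topological_group_def topological_group_axioms_def)
qed

end

lemma h_complete_closed_image:
  fixes G :: "('a, 'm) monoid_scheme" and L :: "('b, 'n) monoid_scheme"
  assumes G: "topological_group G T" and hc: "h_complete G T"
    and L: "topological_group L TL"
    and hom: "\<phi> \<in> hom G L" and cont: "continuous_map T TL \<phi>"
  shows "closedin TL (\<phi> ` carrier G)"
proof -
  interpret G: topological_group G T by (rule G)
  interpret L: topological_group L TL by (rule L)
  interpret group_hom G L \<phi>
    using hom by unfold_locales
  define S where "S = \<phi> ` carrier G"
  define C where "C = TL closure_of S"
  have S: "subgroup S L"
    unfolding S_def by (rule img_is_subgroup)
  have C: "subgroup C L"
    unfolding C_def by (rule L.subgroup_closure_of[OF S])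
  have Cclosed: "closedin TL C"
    by (simp add: C_def)
  have SC: "S \<subseteq> C"
    unfolding C_def using S L.topspace_eq by (metis closure_of_subset subgroup.subset)
  define j where "j = (\<lambda>y. {{x \<in> carrier G. \<phi> x \<in> U} | U. openin TL U \<and> y \<in> U})"
  have j: "inj_on j C"
  proof (rule inj_onI, rule ccontr)
    fix y z assume yz: "y \<in> C" "z \<in> C" "j y = j z" "y \<noteq> z"
    then have "y \<in> topspace TL" "z \<in> topspace TL"
      using Cclosed closedin_subset by blast+
    then obtain U V where UV: "openin TL U" "openin TL V" "y \<in> U" "z \<in> V" "disjnt U V"
      using L.Hausdorff yz(4) unfolding Hausdorff_space_def by metis
    then have "{x \<in> carrier G. \<phi> x \<in> U} \<in> j z"
      using yz(3) unfolding j_def by blast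
    then obtain W where W: "openin TL W" "z \<in> W"
      "{x \<in> carrier G. \<phi> x \<in> U} = {x \<in> carrier G. \<phi> x \<in> W}"
      unfolding j_def by blast
    have "openin TL (W \<inter> V)" "z \<in> W \<inter> V"
      using W UV by auto
    then obtain s where "s \<in> S" "s \<in> W \<inter> V"
      using yz(2) unfolding C_def in_closure_of by blast
    then obtain x where "x \<in> carrier G" "\<phi> x \<in> W" "\<phi> x \<in> V"
      unfolding S_def by blast
    then show False
      using W(3) UV(5) unfolding disjnt_def by blast
  qed
  define i where "i = inv_into C j"
  define L' where
    "L' = \<lparr>carrier = j ` C, mult = \<lambda>a b. j (i a \<otimes>\<^bsub>L\<^esub> i b), one = j \<one>\<^bsub>L\<^esub>\<rparr>"
  define T' where "T' = pullback_topology (j ` C) i TL"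
  have L': "topological_group L' T'"
    unfolding L'_def T'_def i_def by (rule L.topological_group_transport[OF C j])
  have ij: "i (j x) = x" if "x \<in> C" for x
    using that j by (simp add: i_def)
  have \<phi>C: "\<phi> x \<in> C" if "x \<in> carrier G" for x
    using that SC S_def by blast
  have hom': "j \<circ> \<phi> \<in> hom G L'"
    unfolding hom_def L'_def using \<phi>C ij by (auto simp: Pi_iff)
  have "continuous_map T T' (j \<circ> \<phi>)"
    unfolding T'_def
  proof (rule continuous_map_pullback')
    show "continuous_map T TL (i \<circ> (j \<circ> \<phi>))"
      by (rule continuous_map_eq[OF cont]) (use \<phi>C ij G.topspace_eq in auto)
    show "topspace T \<subseteq> (j \<circ> \<phi>) -` (j ` C)"
      using \<phi>C G.topspace_eq by auto
  qed
  with hc L' hom' have cl: "closedin T' ((j \<circ> \<phi>) ` carrier G)"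
    unfolding h_complete_def by blast
  have "continuous_map (subtopology TL C) T' j"
    unfolding T'_def
  proof (rule continuous_map_pullback')
    have "continuous_map (subtopology TL C) TL id"
      by (simp add: continuous_map_from_subtopology)
    then show "continuous_map (subtopology TL C) TL (i \<circ> j)"
      by (rule continuous_map_eq) (use ij in auto)
  qed auto
  from closedin_continuous_map_preimage[OF this cl]
  have "closedin (subtopology TL C) {y \<in> topspace (subtopology TL C). j y \<in> j ` S}"
    by (simp add: S_def image_comp)
  moreover have "{y \<in> topspace (subtopology TL C). j y \<in> j ` S} = S"
    using j SC Cclosed closedin_subset[of TL C] by (auto simp: inj_on_def)
  ultimately show ?thesis
    using closedin_trans_full[OF _ Cclosed] S_def by metis
qed

end

theory Submission
  imports Defs "HOL-Algebra.Generated_Groups"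
begin

text \<open>
  The proof reduces the theorem to Banach's open mapping theorem for Polish groups, one separable
  subgroup at a time. If \<open>f\<close> is not open, then there are a neighbourhood \<open>W\<close> of
  \<open>\<one>\<close> in \<open>G\<close> and elements \<open>g m\<close> such that \<open>f (g m)\<close> tends to \<open>\<one>\<close> in
  \<open>H\<close> while \<open>g m\<close> lies outside \<open>W\<close> times the kernel of \<open>f\<close>. The closure \<open>K\<close> of the
  subgroup generated by the \<open>g m\<close> is separable, and it is h-complete because \<open>G\<close> is
  hereditarily so. It therefore suffices to contradict the choice of the \<open>g m\<close> inside \<open>K\<close>.

  The topology of \<open>K\<close> need not be metrizable. Separability, however, allows one to
  choose a sequence \<open>V\<close> of neighbourhoods of \<open>\<one>\<close> in \<open>K\<close>, starting inside
  \<open>W\<close>, that defines a coarser group topology: closure under conjugation only has to be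
  arranged for the countably many elements of a dense set (\<open>separable_scale\<close>). Such a sequence is
  called a scale below. The preimages under \<open>f\<close> of a neighbourhood base of
  \<open>\<one>\<close> in \<open>H\<close> form another scale \<open>U\<close>, and \<open>V\<close> can be chosen finer than
  \<open>U\<close>.

  The h-completeness of \<open>K\<close> makes both scales complete in the sense of Raikov: two-sided Cauchy
  sequences modulo null sequences form a Hausdorff group in which the image of \<open>K\<close> is dense,
  hence equal to everything (\<open>scale_complete_if_h_complete\<close>). The open mapping theorem is thus
  a statement about a group with two complete scales, the finer of which is covered by countably
  many translates of each of its members: then each \<open>V n\<close>, multiplied by the intersection of
  the \<open>U k\<close>, contains some \<open>U m\<close> (\<open>open_mapping\<close>). For \<open>n = 0\<close> this
  contradicts the choice of the \<open>g m\<close>.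
\<close>

section \<open>Scales on a group and their completeness\<close>

text \<open>
  Together with associativity, the unit and inverse laws and the rule for the inverse of a product,
  these two equations rewrite every word in a group to its reduced form.
\<close>
lemma (in group) cancel_inv:
  assumes "x \<in> carrier G" "y \<in> carrier G"
  shows "x \<otimes> (inv x \<otimes> y) = y" "inv x \<otimes> (x \<otimes> y) = y"
  using assms by (simp_all flip: m_assoc)

text \<open>
  A scale is a countable neighbourhood base of \<open>\<one>\<close> for a group topology, which may fail to be
  Hausdorff. Working with the base instead of the topology allows several coarser topologies on
  one group to be handled by purely algebraic means.
\<close>
locale group_scale = group G for G (structure) and V :: "nat \<Rightarrow> 'a set" +
  assumes scale_subset: "V n \<subseteq> carrier G"
    and scale_one: "\<one> \<in> V n"
    and scale_inv: "v \<in> V n \<Longrightarrow> inv v \<in> V n"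
    and scale_mult: "v \<in> V (Suc n) \<Longrightarrow> w \<in> V (Suc n) \<Longrightarrow> v \<otimes> w \<in> V n"
    and scale_conj: "x \<in> carrier G \<Longrightarrow> \<exists>m. \<forall>v\<in>V m. x \<otimes> v \<otimes> inv x \<in> V n"
begin

lemma scale_carrier: "v \<in> V n \<Longrightarrow> v \<in> carrier G"
  using scale_subset by blast

lemma scale_antimono: "m \<le> n \<Longrightarrow> V n \<subseteq> V m"
proof (rule lift_Suc_antimono_le)
  show "V (Suc k) \<subseteq> V k" for k
    using scale_mult[of _ k \<one>] scale_one scale_carrier by fastforce
qed

lemma scale_le: "v \<in> V n \<Longrightarrow> m \<le> n \<Longrightarrow> v \<in> V m"
  using scale_antimono by blast

lemma scale_divide:
  assumes "v \<in> V (Suc n)" "w \<in> V (Suc n)"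
  shows "inv v \<otimes> w \<in> V n" "v \<otimes> inv w \<in> V n"
  using assms by (simp_all add: scale_mult scale_inv)

lemma scale_conj_ge:
  assumes "x \<in> carrier G"
  obtains m where "m \<ge> l" "\<And>v. v \<in> V m \<Longrightarrow> x \<otimes> v \<otimes> inv x \<in> V n"
proof -
  obtain m where "\<forall>v\<in>V m. x \<otimes> v \<otimes> inv x \<in> V n"
    using scale_conj[OF assms] by blast
  then show thesis
    by (intro that[of "max l m"]) (auto dest: scale_le[of _ _ m])
qed

text \<open>
  Cauchy sequences are two-sided: requiring only the first condition would turn completeness into
  completeness in the sense of Weil, which even Polish groups can lack.
\<close>
definition cauchy :: "(nat \<Rightarrow> 'a) \<Rightarrow> bool" where
  "cauchy x \<longleftrightarrow> range x \<subseteq> carrier G \<and>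
    (\<forall>n. \<exists>N. \<forall>i\<ge>N. \<forall>j\<ge>N. inv (x i) \<otimes> x j \<in> V n \<and> x i \<otimes> inv (x j) \<in> V n)"

definition scale_complete :: bool where
  "scale_complete \<longleftrightarrow>
    (\<forall>x. cauchy x \<longrightarrow> (\<exists>y\<in>carrier G. \<forall>n. \<exists>N. \<forall>i\<ge>N. inv (x i) \<otimes> y \<in> V n))"

text \<open>
  Cantor's intersection principle for the left translates \<open>x k \<otimes> V (m k)\<close>. That each
  centre lies in the preceding translate only bounds the quotients \<open>inv (x i) \<otimes> x j\<close>; the
  assumption \<open>conj\<close>, which says that \<open>m k\<close> is large in terms of \<open>x k\<close>, bounds
  \<open>x i \<otimes> inv (x j)\<close> as well. The two extra indices in \<open>step\<close> pay for one
  multiplication in passing to the later centres and one in passing to the limit.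
\<close>
lemma nested_balls:
  assumes complete: scale_complete
    and x: "\<And>k. x k \<in> carrier G"
    and step: "\<And>k. inv (x k) \<otimes> x (Suc k) \<in> V (m k + 2)"
    and m: "\<And>k. m k < m (Suc k)"
    and conj: "\<And>k v. v \<in> V (m k) \<Longrightarrow> x k \<otimes> v \<otimes> inv (x k) \<in> V k"
  shows "\<exists>y\<in>carrier G. \<forall>k. inv (x k) \<otimes> y \<in> V (m k)"
proof -
  have tail: "inv (x k) \<otimes> x (k + j) \<in> V (m k + 1)" for k j
  proof (induction j arbitrary: k)
    case 0
    then show ?case using x scale_one by simp
  next
    case (Suc j)
    have "inv (x (Suc k)) \<otimes> x (Suc k + j) \<in> V (m k + 2)"
      using Suc[of "Suc k"] m[of k] by (auto intro: scale_le)
    then have "(inv (x k) \<otimes> x (Suc k)) \<otimes> (inv (x (Suc k)) \<otimes> x (Suc k + j)) \<in> V (m k + 1)"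
      using step[of k] by (auto intro: scale_mult)
    then show ?case using x by (simp add: m_assoc cancel_inv)
  qed
  have mk: "k \<le> m k" for k
    using m by (intro strict_mono_imp_increasing strict_mono_Suc_iff[THEN iffD2]) auto
  have near: "inv (x k) \<otimes> x i \<in> V k" "x i \<otimes> inv (x k) \<in> V k" if "k \<le> i" for k i
  proof -
    have *: "inv (x k) \<otimes> x i \<in> V (m k + 1)"
      using tail[of k "i - k"] that by simp
    then show "inv (x k) \<otimes> x i \<in> V k"
      using mk[of k] by (auto intro: scale_le)
    have "x k \<otimes> (inv (x k) \<otimes> x i) \<otimes> inv (x k) \<in> V k"
      using conj scale_le[OF *, of "m k"] by simp
    then show "x i \<otimes> inv (x k) \<in> V k"
      using x by (simp add: cancel_inv)
  qed
  have "cauchy x"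
    unfolding cauchy_def
  proof (intro conjI allI exI impI)
    show "range x \<subseteq> carrier G" using x by blast
    fix n i j assume ij: "Suc n \<le> i" "Suc n \<le> j"
    let ?c = "x (Suc n)"
    have "inv (inv ?c \<otimes> x i) \<otimes> (inv ?c \<otimes> x j) \<in> V n"
      by (rule scale_divide(1)[OF near(1)[OF ij(1)] near(1)[OF ij(2)]])
    then show "inv (x i) \<otimes> x j \<in> V n"
      using x by (simp add: m_assoc inv_mult_group cancel_inv)
    have "(x i \<otimes> inv ?c) \<otimes> inv (x j \<otimes> inv ?c) \<in> V n"
      by (rule scale_divide(2)[OF near(2)[OF ij(1)] near(2)[OF ij(2)]])
    then show "x i \<otimes> inv (x j) \<in> V n"
      using x by (simp add: m_assoc inv_mult_group cancel_inv)
  qed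
  then obtain y where y: "y \<in> carrier G" "\<And>n. \<exists>N. \<forall>i\<ge>N. inv (x i) \<otimes> y \<in> V n"
    using complete unfolding scale_complete_def by blast
  show ?thesis
  proof (intro bexI[OF _ y(1)] allI)
    fix k
    obtain N where N: "\<And>i. i \<ge> N \<Longrightarrow> inv (x i) \<otimes> y \<in> V (m k + 1)"
      using y(2) by blast
    have "(inv (x k) \<otimes> x (k + N)) \<otimes> (inv (x (k + N)) \<otimes> y) \<in> V (m k)"
      using tail[of k N] N[of "k + N"] by (auto intro: scale_mult)
    then show "inv (x k) \<otimes> y \<in> V (m k)"
      using x y(1) by (simp add: m_assoc cancel_inv)
  qed
qed

end

section \<open>The open mapping theorem for complete scales\<close>

locale two_scales = V: group_scale G V + U: group_scale G U
  for G (structure) and V U :: "nat \<Rightarrow> 'a set" +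
  assumes finer: "V n \<subseteq> U n"
begin

text \<open>The closure of \<open>V n\<close> in the topology whose neighbourhood base is \<open>U\<close>.\<close>
definition coarse_closure :: "nat \<Rightarrow> 'a set" where
  "coarse_closure n = {x \<in> carrier G. \<forall>m. \<exists>u\<in>U m. x \<otimes> u \<in> V n}"

text \<open>
  Division maps \<open>V (Suc n) \<times> V (Suc n)\<close> into \<open>V n\<close> and is continuous for
  \<open>U\<close>, so it maps the closures accordingly. The error \<open>inv u\<close>, which arises to the left of the
  fixed element \<open>c\<close>, is moved to its right by conjugation.
\<close>
lemma coarse_closure_quotient:
  assumes "a \<in> coarse_closure (Suc n)" "b \<in> coarse_closure (Suc n)"
  shows "inv a \<otimes> b \<in> coarse_closure n"
proof -
  have ab: "a \<in> carrier G" "b \<in> carrier G"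
    using assms by (auto simp: coarse_closure_def)
  define c where "c = inv a \<otimes> b"
  have c: "c \<in> carrier G" using ab by (simp add: c_def)
  have "\<exists>u\<in>U m. c \<otimes> u \<in> V n" for m
  proof -
    obtain l where l: "\<And>v. v \<in> U l \<Longrightarrow> inv c \<otimes> v \<otimes> inv (inv c) \<in> U (Suc m)"
      using U.scale_conj[of "inv c" "Suc m"] c by auto
    obtain u where u: "u \<in> U l" "a \<otimes> u \<in> V (Suc n)"
      using assms(1) by (auto simp: coarse_closure_def)
    obtain w where w: "w \<in> U (Suc m)" "b \<otimes> w \<in> V (Suc n)"
      using assms(2) by (auto simp: coarse_closure_def)
    have uw: "u \<in> carrier G" "w \<in> carrier G"
      using u w U.scale_carrier by auto
    have "inv (a \<otimes> u) \<otimes> (b \<otimes> w) \<in> V n"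
      by (rule V.scale_divide(1)[OF u(2) w(2)])
    then have "c \<otimes> ((inv c \<otimes> inv u \<otimes> inv (inv c)) \<otimes> w) \<in> V n"
      using ab uw by (simp add: c_def V.m_assoc V.inv_mult_group V.cancel_inv)
    moreover have "(inv c \<otimes> inv u \<otimes> inv (inv c)) \<otimes> w \<in> U m"
      by (rule U.scale_mult[OF l[OF U.scale_inv[OF u(1)]] w(1)])
    ultimately show ?thesis by blast
  qed
  then show ?thesis
    using c unfolding coarse_closure_def c_def by blast
qed

text \<open>
  This is the Baire category argument. The group is covered by the translates
  \<open>d i \<otimes> V (Suc n)\<close>. If no \<open>U m\<close> is contained in the closure of \<open>V n\<close>,
  then, dividing, no translate of a \<open>U m\<close> is contained in the closure of
  \<open>d i \<otimes> V (Suc n)\<close>. One can therefore shrink balls successively so as to avoid all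
  these sets, and the common point of the balls is covered by none of them.
\<close>
lemma coarse_closure_neighbourhood:
  fixes d :: "nat \<Rightarrow> 'a"
  assumes complete: U.scale_complete
    and d: "\<And>i. d i \<in> carrier G"
    and cover: "\<And>x. x \<in> carrier G \<Longrightarrow> \<exists>i. inv (d i) \<otimes> x \<in> V (Suc n)"
  shows "\<exists>m. U m \<subseteq> coarse_closure n"
proof (rule ccontr)
  assume no: "\<nexists>m. U m \<subseteq> coarse_closure n"
  have leave: "\<exists>u\<in>U m. inv (d i) \<otimes> (x \<otimes> u) \<notin> coarse_closure (Suc n)"
    if x: "x \<in> carrier G" for x i m
  proof (rule ccontr)
    assume "\<not> ?thesis"
    then have in_cl: "inv (d i) \<otimes> (x \<otimes> u) \<in> coarse_closure (Suc n)" if "u \<in> U m" for u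
      using that by blast
    have "u \<in> coarse_closure n" if u: "u \<in> U m" for u
    proof -
      have "inv (inv (d i) \<otimes> (x \<otimes> \<one>)) \<otimes> (inv (d i) \<otimes> (x \<otimes> u)) \<in> coarse_closure n"
        using in_cl[OF U.scale_one] in_cl[OF u] by (rule coarse_closure_quotient)
      then show ?thesis
        using x d u U.scale_carrier by (simp add: V.m_assoc V.inv_mult_group V.cancel_inv)
    qed
    then show False using no by blast
  qed
  \<comment> \<open>A state \<open>(x, m)\<close> stands for the ball \<open>x \<otimes> U m\<close>; after step \<open>k\<close> the
    ball is disjoint from \<open>d k \<otimes> V (Suc n)\<close>.\<close>
  define P where "P k = (\<lambda>(x, m). x \<in> carrier G \<and>
    (\<forall>v\<in>U m. x \<otimes> v \<otimes> inv x \<in> U k))" for k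
  define Q where "Q k = (\<lambda>(x, m) (x', m'). inv x \<otimes> x' \<in> U (m + 2) \<and> m < m' \<and>
    (\<forall>u\<in>U m'. inv (d k) \<otimes> (x' \<otimes> u) \<notin> V (Suc n)))" for k :: nat
  have "\<exists>f. \<forall>k. P k (f k) \<and> Q k (f k) (f (Suc k))"
  proof (rule dependent_nat_choice)
    show "\<exists>s. P 0 s"
      by (rule exI[of _ "(\<one>, 0)"]) (use U.scale_carrier in \<open>auto simp: P_def\<close>)
  next
    fix s k assume "P k s"
    obtain x m where s: "s = (x, m)" by fastforce
    have x: "x \<in> carrier G" using \<open>P k s\<close> s by (simp add: P_def)
    obtain u where u: "u \<in> U (m + 2)" "inv (d k) \<otimes> (x \<otimes> u) \<notin> coarse_closure (Suc n)"
      using leave[OF x] by blast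
    define x' where "x' = x \<otimes> u"
    have x': "x' \<in> carrier G" using x u U.scale_carrier by (simp add: x'_def)
    obtain l where l: "\<forall>w\<in>U l. inv (d k) \<otimes> x' \<otimes> w \<notin> V (Suc n)"
      using u(2) x' d by (auto simp: coarse_closure_def x'_def)
    obtain m' where m': "m' \<ge> max l (Suc m)"
      "\<And>v. v \<in> U m' \<Longrightarrow> x' \<otimes> v \<otimes> inv x' \<in> U (Suc k)"
      using U.scale_conj_ge[OF x'] by blast
    have "inv (d k) \<otimes> (x' \<otimes> w) \<notin> V (Suc n)" if "w \<in> U m'" for w
    proof -
      have "w \<in> U l" using that m'(1) by (auto intro: U.scale_le)
      then show ?thesis using l x' d U.scale_carrier by (simp add: V.m_assoc)
    qed
    moreover have "inv x \<otimes> x' \<in> U (m + 2)"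
      using u x U.scale_carrier by (simp add: x'_def V.cancel_inv)
    ultimately have "P (Suc k) (x', m') \<and> Q k s (x', m')"
      using x' m' by (auto simp: P_def Q_def s)
    then show "\<exists>s'. P (Suc k) s' \<and> Q k s s'" by blast
  qed
  then obtain f where f: "\<And>k. P k (f k)" "\<And>k. Q k (f k) (f (Suc k))" by blast
  define x where "x k = fst (f k)" for k
  define m where "m k = snd (f k)" for k
  have x: "x k \<in> carrier G" and conj: "v \<in> U (m k) \<Longrightarrow> x k \<otimes> v \<otimes> inv (x k) \<in> U k" for k v
    using f(1)[of k] by (auto simp: P_def x_def m_def split_beta)
  have step: "inv (x k) \<otimes> x (Suc k) \<in> U (m k + 2)" and m: "m k < m (Suc k)"
    and avoid: "u \<in> U (m (Suc k)) \<Longrightarrow> inv (d k) \<otimes> (x (Suc k) \<otimes> u) \<notin> V (Suc n)" for k u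
    using f(2)[of k] by (auto simp: Q_def x_def m_def split_beta)
  obtain y where y: "y \<in> carrier G" "\<And>k. inv (x k) \<otimes> y \<in> U (m k)"
    using U.nested_balls[OF complete x step m conj] by blast
  obtain k where "inv (d k) \<otimes> y \<in> V (Suc n)"
    using cover[OF y(1)] by blast
  then show False
    using avoid[OF y(2), of k] x y(1) by (simp add: V.cancel_inv)
qed

text \<open>
  Each \<open>U (r a)\<close> is contained in the \<open>U\<close>-closure of \<open>V (a + 2)\<close>. Given
  \<open>h\<close> in a suitable \<open>U m\<close>, one constructs \<open>y\<close> and \<open>z\<close> in \<open>V (Suc n)\<close> such
  that \<open>y\<close> and \<open>h \<otimes> z\<close> agree up to the intersection of the \<open>U k\<close>. They are limits
  of sequences \<open>p\<close> and \<open>q\<close> which are corrected alternately, \<open>p k\<close> moving towards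
  \<open>h \<otimes> q k\<close> and then \<open>h \<otimes> q k\<close> towards \<open>p (Suc k)\<close>.

  Two moving points are essential. To make \<open>p\<close> a two-sided Cauchy sequence, the radius at
  \<open>p k\<close> must be chosen after \<open>p k\<close>, so with a fixed target \<open>h\<close> the error would have to
  be small in terms of a radius that is not yet known. Here the error of the new \<open>p\<close> is measured
  against the current radius at \<open>q k\<close>, and conversely.
\<close>
theorem open_mapping:
  fixes d :: "nat \<Rightarrow> 'a"
  assumes V_complete: V.scale_complete and U_complete: U.scale_complete
    and d: "\<And>i. d i \<in> carrier G"
    and cover: "\<And>n x. x \<in> carrier G \<Longrightarrow> \<exists>i. inv (d i) \<otimes> x \<in> V n"
  shows "\<exists>m. \<forall>h\<in>U m. \<exists>v\<in>V n. inv v \<otimes> h \<in> (\<Inter>k. U k)"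
proof -
  have "\<exists>r\<ge>a. U r \<subseteq> coarse_closure (a + 2)" for a
  proof -
    obtain m where "U m \<subseteq> coarse_closure (a + 2)"
      using coarse_closure_neighbourhood[OF U_complete d cover] by blast
    then show ?thesis
      using U.scale_antimono[of m "max a m"] by (intro exI[of _ "max a m"]) auto
  qed
  then obtain r where r: "\<And>a. r a \<ge> a" "\<And>a. U (r a) \<subseteq> coarse_closure (a + 2)"
    by metis
  have approx: "\<exists>z\<in>carrier G. inv x \<otimes> z \<in> V (a + 2) \<and> inv y \<otimes> z \<in> U s"
    if xy: "x \<in> carrier G" "y \<in> carrier G" "inv x \<otimes> y \<in> U (r a)" for x y a s
  proof -
    obtain u where u: "u \<in> U s" "inv x \<otimes> y \<otimes> u \<in> V (a + 2)"
      using r(2)[of a] xy(3) by (auto simp: coarse_closure_def)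
    then show ?thesis
      using xy U.scale_carrier[OF u(1)]
      by (intro bexI[of _ "y \<otimes> u"]) (auto simp: V.m_assoc V.cancel_inv)
  qed
  have "\<exists>v\<in>V n. inv v \<otimes> h \<in> (\<Inter>k. U k)" if h: "h \<in> U (r (Suc n))" for h
  proof -
    have hG: "h \<in> carrier G" using h U.scale_carrier by blast
    \<comment> \<open>A state consists of the points \<open>p\<close>, \<open>q\<close> with their radii \<open>a\<close>, \<open>b\<close>.
      The equations for \<open>k = 0\<close> ensure that both limits lie in \<open>V (Suc n)\<close>.\<close>
    define P where "P k = (\<lambda>(p, a, q, b). p \<in> carrier G \<and> q \<in> carrier G \<and>
      (\<forall>v\<in>V a. p \<otimes> v \<otimes> inv p \<in> V k) \<and> (\<forall>v\<in>V b. q \<otimes> v \<otimes> inv q \<in> V k) \<and>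
      inv p \<otimes> (h \<otimes> q) \<in> U (r a) \<and> (k = 0 \<longrightarrow> p = \<one> \<and> q = \<one> \<and> a = Suc n \<and> b = Suc n))" for k :: nat
    define Q where "Q k = (\<lambda>(p, a, q, b) (p', a', q', b').
      inv p \<otimes> p' \<in> V (a + 2) \<and> a < a' \<and> inv q \<otimes> q' \<in> V (b + 2) \<and> b < b')" for k :: nat
    have "\<exists>f. \<forall>k. P k (f k) \<and> Q k (f k) (f (Suc k))"
    proof (rule dependent_nat_choice)
      have "P 0 (\<one>, Suc n, \<one>, Suc n)"
        using h hG V.scale_carrier by (auto simp: P_def intro: V.scale_le)
      then show "\<exists>s. P 0 s" by blast
    next
      fix s k assume "P k s"
      obtain p a q b where s: "s = (p, a, q, b)" by (cases s) auto
      have pq: "p \<in> carrier G" "q \<in> carrier G" and close: "inv p \<otimes> (h \<otimes> q) \<in> U (r a)"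
        using \<open>P k s\<close> s by (auto simp: P_def)
      obtain p' where p': "p' \<in> carrier G" "inv p \<otimes> p' \<in> V (a + 2)"
        "inv (h \<otimes> q) \<otimes> p' \<in> U (r b)"
        using approx[OF pq(1) _ close, of "r b"] hG pq by auto
      obtain a' where a': "a' \<ge> Suc a" "\<And>v. v \<in> V a' \<Longrightarrow> p' \<otimes> v \<otimes> inv p' \<in> V (Suc k)"
        using V.scale_conj_ge[OF p'(1)] by blast
      have "inv q \<otimes> (inv h \<otimes> p') \<in> U (r b)"
        using p' pq hG by (simp add: V.inv_mult_group V.m_assoc)
      then obtain q' where q': "q' \<in> carrier G" "inv q \<otimes> q' \<in> V (b + 2)"
        "inv (inv h \<otimes> p') \<otimes> q' \<in> U (r a')"
        using approx[OF pq(2), of "inv h \<otimes> p'" b "r a'"] hG p' by auto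
      obtain b' where b': "b' \<ge> Suc b" "\<And>v. v \<in> V b' \<Longrightarrow> q' \<otimes> v \<otimes> inv q' \<in> V (Suc k)"
        using V.scale_conj_ge[OF q'(1)] by blast
      have "inv p' \<otimes> (h \<otimes> q') \<in> U (r a')"
        using q' p' hG by (simp add: V.inv_mult_group V.m_assoc)
      then have "P (Suc k) (p', a', q', b') \<and> Q k s (p', a', q', b')"
        using p' q' a' b' by (auto simp: P_def Q_def s)
      then show "\<exists>s'. P (Suc k) s' \<and> Q k s s'" by blast
    qed
    then obtain f where f: "\<And>k. P k (f k)" "\<And>k. Q k (f k) (f (Suc k))" by blast
    define p where "p k = fst (f k)" for k
    define a where "a k = fst (snd (f k))" for k
    define q where "q k = fst (snd (snd (f k)))" for k
    define b where "b k = snd (snd (snd (f k)))" for k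
    have pq: "p k \<in> carrier G" "q k \<in> carrier G"
      and conj: "v \<in> V (a k) \<Longrightarrow> p k \<otimes> v \<otimes> inv (p k) \<in> V k"
        "v \<in> V (b k) \<Longrightarrow> q k \<otimes> v \<otimes> inv (q k) \<in> V k"
      and close: "inv (p k) \<otimes> (h \<otimes> q k) \<in> U (r (a k))" for k v
      using f(1)[of k] by (auto simp: P_def p_def a_def q_def b_def split_beta)
    have start: "p 0 = \<one>" "q 0 = \<one>" "a 0 = Suc n" "b 0 = Suc n"
      using f(1)[of 0] by (auto simp: P_def p_def a_def q_def b_def split_beta)
    have step: "inv (p k) \<otimes> p (Suc k) \<in> V (a k + 2)" "inv (q k) \<otimes> q (Suc k) \<in> V (b k + 2)"
      and less: "a k < a (Suc k)" "b k < b (Suc k)" for k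
      using f(2)[of k] by (auto simp: Q_def p_def a_def q_def b_def split_beta)
    obtain y where y: "y \<in> carrier G" "\<And>k. inv (p k) \<otimes> y \<in> V (a k)"
      using V.nested_balls[OF V_complete pq(1) step(1) less(1) conj(1)] by blast
    obtain z where z: "z \<in> carrier G" "\<And>k. inv (q k) \<otimes> z \<in> V (b k)"
      using V.nested_balls[OF V_complete pq(2) step(2) less(2) conj(2)] by blast
    have ab: "k \<le> a k" "k \<le> b k" for k
      using less by (auto intro!: strict_mono_imp_increasing strict_mono_Suc_iff[THEN iffD2])
    have limit: "inv y \<otimes> (h \<otimes> z) \<in> U k" for k
    proof -
      let ?k = "Suc (Suc k)"
      have 1: "inv (p ?k) \<otimes> y \<in> U ?k" and 2: "inv (q ?k) \<otimes> z \<in> U ?k"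
        using y z ab finer by (meson subsetD U.scale_le)+
      have 3: "inv (p ?k) \<otimes> (h \<otimes> q ?k) \<in> U ?k"
        using close[of ?k] r(1)[of "a ?k"] ab(1)[of ?k] by (auto intro: U.scale_le)
      have "inv (inv (p ?k) \<otimes> y) \<otimes> (inv (p ?k) \<otimes> (h \<otimes> q ?k)) \<otimes> (inv (q ?k) \<otimes> z) \<in> U k"
        by (rule U.scale_mult[OF U.scale_divide(1)[OF 1 3] U.scale_le[OF 2]]) simp
      then show ?thesis
        using pq y z hG by (simp add: V.m_assoc V.inv_mult_group V.cancel_inv)
    qed
    have "y \<in> V (Suc n)" "z \<in> V (Suc n)"
      using y(2)[of 0] z(2)[of 0] start y(1) z(1) by auto
    then have "y \<otimes> inv z \<in> V n"
      by (rule V.scale_divide)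
    \<comment> \<open>The intersection of the \<open>U k\<close> is normal, so the factor \<open>z\<close> can be moved across.\<close>
    moreover have "inv (y \<otimes> inv z) \<otimes> h \<in> U k" for k
    proof -
      obtain l where l: "\<forall>v\<in>U l. z \<otimes> v \<otimes> inv z \<in> U k"
        using U.scale_conj[OF z(1)] by blast
      then have "z \<otimes> (inv y \<otimes> (h \<otimes> z)) \<otimes> inv z \<in> U k"
        using limit by blast
      then show ?thesis
        using y(1) z(1) hG by (simp add: V.m_assoc V.inv_mult_group V.cancel_inv)
    qed
    ultimately show ?thesis by blast
  qed
  then show ?thesis by blast
qed

end

section \<open>The Hausdorff group associated with a scale\<close>

context topological_group
begin

lemma continuous_map_translations:
  assumes a: "a \<in> carrier G"
  shows "continuous_map T T (\<lambda>x. a \<otimes> x)" "continuous_map T T (\<lambda>x. x \<otimes> a)"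
proof -
  have "continuous_map T (prod_topology T T) (\<lambda>x. (a, x))"
    "continuous_map T (prod_topology T T) (\<lambda>x. (x, a))"
    using a topspace_eq by (auto intro!: continuous_map_pairedI)
  from this[THEN continuous_map_compose, OF continuous_mult]
  show "continuous_map T T (\<lambda>x. a \<otimes> x)" "continuous_map T T (\<lambda>x. x \<otimes> a)"
    by (simp_all add: o_def)
qed

lemma openin_translate:
  assumes "openin T S" "a \<in> carrier G"
  shows "openin T {x \<in> carrier G. inv a \<otimes> x \<in> S}"
  using openin_continuous_map_preimage[OF continuous_map_translations(1) assms(1)] assms(2)
  by (simp add: topspace_eq)

end

context group_scale
begin

definition scale_topology :: "'a topology" where
  "scale_topology = topology (\<lambda>S. S \<subseteq> carrier G \<and> (\<forall>x\<in>S. \<exists>n. \<forall>v\<in>V n. x \<otimes> v \<in> S))"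

lemma openin_scale_topology:
  "openin scale_topology S \<longleftrightarrow> S \<subseteq> carrier G \<and> (\<forall>x\<in>S. \<exists>n. \<forall>v\<in>V n. x \<otimes> v \<in> S)"
proof -
  have "istopology (\<lambda>S. S \<subseteq> carrier G \<and> (\<forall>x\<in>S. \<exists>n. \<forall>v\<in>V n. x \<otimes> v \<in> S))"
    unfolding istopology_def
  proof (intro conjI allI impI ballI)
    fix S S' x
    assume S: "S \<subseteq> carrier G \<and> (\<forall>x\<in>S. \<exists>n. \<forall>v\<in>V n. x \<otimes> v \<in> S)"
      "S' \<subseteq> carrier G \<and> (\<forall>x\<in>S'. \<exists>n. \<forall>v\<in>V n. x \<otimes> v \<in> S')" and x: "x \<in> S \<inter> S'"
    then obtain m n where mn: "\<forall>v\<in>V m. x \<otimes> v \<in> S" "\<forall>v\<in>V n. x \<otimes> v \<in> S'"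
      by blast
    have "\<forall>v\<in>V (max m n). x \<otimes> v \<in> S \<inter> S'"
      using mn scale_antimono[of m "max m n"] scale_antimono[of n "max m n"] by auto
    then show "\<exists>n. \<forall>v\<in>V n. x \<otimes> v \<in> S \<inter> S'" by blast
  next
    fix \<S> x
    assume \<S>: "\<forall>S\<in>\<S>. S \<subseteq> carrier G \<and> (\<forall>x\<in>S. \<exists>n. \<forall>v\<in>V n. x \<otimes> v \<in> S)" and "x \<in> \<Union>\<S>"
    then obtain S where S: "S \<in> \<S>" "x \<in> S" by blast
    then obtain n where "\<forall>v\<in>V n. x \<otimes> v \<in> S" using \<S> by blast
    then show "\<exists>n. \<forall>v\<in>V n. x \<otimes> v \<in> \<Union>\<S>" using S by blast
  qed blast+
  then show ?thesis by (simp add: scale_topology_def topology_inverse')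
qed

lemma topspace_scale_topology: "topspace scale_topology = carrier G"
proof -
  have "openin scale_topology (carrier G)"
    using scale_carrier by (auto simp: openin_scale_topology)
  then show ?thesis
    by (metis openin_scale_topology openin_subset openin_topspace subset_antisym)
qed

text \<open>
  The left translates of the scale are neighbourhoods although they need not be open. The witness is
  the interior of \<open>A\<close>, which is open because \<open>V (Suc n)\<close> squares into \<open>V n\<close>.
\<close>
lemma scale_neighbourhood:
  assumes x: "x \<in> carrier G" and A: "\<And>v. v \<in> V n \<Longrightarrow> x \<otimes> v \<in> A"
  shows "\<exists>S. openin scale_topology S \<and> x \<in> S \<and> S \<subseteq> A"
proof (intro exI conjI)
  let ?S = "{y \<in> carrier G. \<exists>n. \<forall>v\<in>V n. y \<otimes> v \<in> A}"
  show "x \<in> ?S" using x A by blast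
  show "?S \<subseteq> A" using scale_one by force
  show "openin scale_topology ?S"
    unfolding openin_scale_topology
  proof (intro conjI ballI)
    fix y assume "y \<in> ?S"
    then obtain n where y: "y \<in> carrier G" "\<forall>v\<in>V n. y \<otimes> v \<in> A" by blast
    have "y \<otimes> v \<in> ?S" if v: "v \<in> V (Suc n)" for v
    proof -
      have "y \<otimes> v \<otimes> w \<in> A" if w: "w \<in> V (Suc n)" for w
        using y(1) y(2)[rule_format, OF scale_mult[OF v w]] scale_carrier[OF v] scale_carrier[OF w]
        by (simp add: m_assoc)
      then show ?thesis using y(1) scale_carrier[OF v] by blast
    qed
    then show "\<exists>n. \<forall>v\<in>V n. y \<otimes> v \<in> ?S" by blast
  qed blast
qed

lemma topological_group_scale_topology:
  assumes separated: "(\<Inter>n. V n) = {\<one>}"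
  shows "topological_group G scale_topology"
proof -
  let ?T = scale_topology
  have mult: "continuous_map (prod_topology ?T ?T) ?T (\<lambda>(x, y). x \<otimes> y)"
    unfolding continuous_map_def
  proof (intro conjI allI impI)
    fix S assume S: "openin ?T S"
    let ?P = "{z \<in> topspace (prod_topology ?T ?T). (case z of (x, y) \<Rightarrow> x \<otimes> y) \<in> S}"
    show "openin (prod_topology ?T ?T) ?P"
      unfolding openin_prod_topology_alt
    proof (intro allI impI)
      fix x y assume "(x, y) \<in> ?P"
      then have xy: "x \<in> carrier G" "y \<in> carrier G" "x \<otimes> y \<in> S"
        by (auto simp: topspace_scale_topology)
      then obtain n where n: "\<forall>v\<in>V n. x \<otimes> y \<otimes> v \<in> S"
        using S by (auto simp: openin_scale_topology)
      obtain m where m: "\<forall>v\<in>V m. inv y \<otimes> v \<otimes> inv (inv y) \<in> V (Suc n)"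
        using scale_conj[of "inv y"] xy by blast
      obtain A where A: "openin ?T A" "x \<in> A" "A \<subseteq> (\<lambda>v. x \<otimes> v) ` V m"
        using scale_neighbourhood[OF xy(1), of m] by blast
      obtain B where B: "openin ?T B" "y \<in> B" "B \<subseteq> (\<lambda>v. y \<otimes> v) ` V (Suc n)"
        using scale_neighbourhood[OF xy(2), of "Suc n"] by blast
      have "x' \<otimes> y' \<in> S" if z: "x' \<in> A" "y' \<in> B" for x' y'
      proof -
        obtain v w where v: "v \<in> V m" "x' = x \<otimes> v" and w: "w \<in> V (Suc n)" "y' = y \<otimes> w"
          using A(3) B(3) z by blast
        have "x \<otimes> y \<otimes> (inv y \<otimes> v \<otimes> inv (inv y) \<otimes> w) \<in> S"
          using m n v w by (blast intro: scale_mult)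
        then show ?thesis
          using xy v w scale_carrier by (simp add: m_assoc cancel_inv)
      qed
      moreover have "A \<subseteq> carrier G" "B \<subseteq> carrier G"
        using A(1) B(1) by (auto simp: openin_scale_topology)
      ultimately have "A \<times> B \<subseteq> ?P" by (auto simp: topspace_scale_topology)
      then show "\<exists>A B. openin ?T A \<and> openin ?T B \<and> x \<in> A \<and> y \<in> B \<and> A \<times> B \<subseteq> ?P"
        using A B by blast
    qed
  qed (auto simp: topspace_scale_topology)
  have inverse: "continuous_map ?T ?T (\<lambda>x. inv x)"
    unfolding continuous_map_def
  proof (intro conjI allI impI)
    fix S assume S: "openin ?T S"
    show "openin ?T {x \<in> topspace ?T. inv x \<in> S}"
      unfolding openin_scale_topology
    proof (intro conjI ballI)
      fix x assume "x \<in> {x \<in> topspace ?T. inv x \<in> S}"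
      then have x: "x \<in> carrier G" "inv x \<in> S" by (auto simp: topspace_scale_topology)
      then obtain n where n: "\<forall>v\<in>V n. inv x \<otimes> v \<in> S"
        using S by (auto simp: openin_scale_topology)
      obtain m where m: "\<forall>v\<in>V m. x \<otimes> v \<otimes> inv x \<in> V n"
        using scale_conj x by blast
      have "inv (x \<otimes> v) \<in> S" if v: "v \<in> V m" for v
      proof -
        have "inv x \<otimes> (x \<otimes> inv v \<otimes> inv x) \<in> S"
          using m n scale_inv[OF v] by blast
        then show ?thesis
          using x scale_carrier[OF v] by (simp add: inv_mult_group m_assoc cancel_inv)
      qed
      then show "\<exists>n. \<forall>v\<in>V n. x \<otimes> v \<in> {x \<in> topspace ?T. inv x \<in> S}"
        using x scale_carrier by (auto simp: topspace_scale_topology intro!: exI[of _ m])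
    qed (auto simp: topspace_scale_topology)
  qed (auto simp: topspace_scale_topology)
  have "Hausdorff_space ?T"
    unfolding Hausdorff_space_def topspace_scale_topology
  proof (intro allI impI)
    fix x y assume "x \<in> carrier G \<and> y \<in> carrier G \<and> x \<noteq> y"
    then have xy: "x \<in> carrier G" "y \<in> carrier G" "x \<noteq> y" by auto
    have "inv x \<otimes> y \<noteq> \<one>"
      using xy by (metis inv_closed inv_equality inv_inv)
    then obtain n where n: "inv x \<otimes> y \<notin> V n"
      using separated by blast
    obtain A where A: "openin ?T A" "x \<in> A" "A \<subseteq> (\<lambda>v. x \<otimes> v) ` V (Suc n)"
      using scale_neighbourhood[OF xy(1), of "Suc n"] by blast
    obtain B where B: "openin ?T B" "y \<in> B" "B \<subseteq> (\<lambda>v. y \<otimes> v) ` V (Suc n)"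
      using scale_neighbourhood[OF xy(2), of "Suc n"] by blast
    have False if z: "z \<in> A" "z \<in> B" for z
    proof -
      obtain v w where v: "v \<in> V (Suc n)" "z = x \<otimes> v" and w: "w \<in> V (Suc n)" "z = y \<otimes> w"
        using A(3) B(3) z by blast
      have "inv x \<otimes> (x \<otimes> v) \<otimes> inv w = inv x \<otimes> (y \<otimes> w) \<otimes> inv w"
        using v w by simp
      then have "v \<otimes> inv w = inv x \<otimes> y"
        using xy v(1) w(1) scale_carrier by (simp add: m_assoc cancel_inv)
      then show False
        using n scale_divide(2)[OF v(1) w(1)] by simp
    qed
    then show "\<exists>A B. openin ?T A \<and> openin ?T B \<and> x \<in> A \<and> y \<in> B \<and> disjnt A B"
      using A B by (metis disjnt_iff)
  qed
  then show ?thesis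
    using mult inverse topspace_scale_topology group_axioms
    by (auto simp: topological_group_def topological_group_axioms_def)
qed

lemma continuous_map_scale_topology:
  assumes K: "topological_group K T" and hom: "\<phi> \<in> hom K G"
    and nbhd: "\<And>n. \<exists>S. openin T S \<and> \<one>\<^bsub>K\<^esub> \<in> S \<and> \<phi> ` S \<subseteq> V n"
  shows "continuous_map T scale_topology \<phi>"
proof -
  interpret K: topological_group K T by (rule K)
  interpret \<phi>: group_hom K G \<phi> using hom by unfold_locales
  show ?thesis
    unfolding continuous_map_def topspace_scale_topology K.topspace_eq
  proof (intro conjI allI impI)
    fix A assume A: "openin scale_topology A"
    show "openin T {x \<in> carrier K. \<phi> x \<in> A}"
    proof (subst openin_subopen, intro ballI)
      fix x assume "x \<in> {x \<in> carrier K. \<phi> x \<in> A}"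
      then have x: "x \<in> carrier K" "\<phi> x \<in> A" by auto
      then obtain n where n: "\<forall>v\<in>V n. \<phi> x \<otimes> v \<in> A"
        using A by (auto simp: openin_scale_topology)
      obtain S where S: "openin T S" "\<one>\<^bsub>K\<^esub> \<in> S" "\<phi> ` S \<subseteq> V n"
        using nbhd by blast
      let ?S = "{y \<in> carrier K. inv\<^bsub>K\<^esub> x \<otimes>\<^bsub>K\<^esub> y \<in> S}"
      have "\<phi> y \<in> A" if y: "y \<in> ?S" for y
      proof -
        have "\<phi> x \<otimes> \<phi> (inv\<^bsub>K\<^esub> x \<otimes>\<^bsub>K\<^esub> y) \<in> A"
          using n S(3) y by blast
        then show ?thesis
          using x y by (simp add: cancel_inv)
      qed
      moreover have "openin T ?S" "x \<in> ?S"
        using K.openin_translate[OF S(1) x(1)] S(2) x(1) by auto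
      ultimately show "\<exists>S. openin T S \<and> x \<in> S \<and> S \<subseteq> {x \<in> carrier K. \<phi> x \<in> A}"
        by blast
    qed
  qed auto
qed

lemma group_scale_image:
  assumes "group_hom G K \<pi>" and onto: "\<pi> ` carrier G = carrier K"
  shows "group_scale K (\<lambda>n. \<pi> ` V n)"
proof -
  interpret \<pi>: group_hom G K \<pi> by fact
  show ?thesis
  proof unfold_locales
    fix x n assume "x \<in> carrier K"
    then obtain c where c: "c \<in> carrier G" "x = \<pi> c" using onto by auto
    obtain m where m: "\<forall>v\<in>V m. c \<otimes> v \<otimes> inv c \<in> V n"
      using scale_conj c by blast
    have "x \<otimes>\<^bsub>K\<^esub> \<pi> v \<otimes>\<^bsub>K\<^esub> inv\<^bsub>K\<^esub> x \<in> \<pi> ` V n" if v: "v \<in> V m" for v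
      using c v scale_carrier[OF v] m by (intro image_eqI[of _ _ "c \<otimes> v \<otimes> inv c"]) auto
    then show "\<exists>m. \<forall>v\<in>\<pi> ` V m. x \<otimes>\<^bsub>K\<^esub> v \<otimes>\<^bsub>K\<^esub> inv\<^bsub>K\<^esub> x \<in> \<pi> ` V n" by blast
  next
    show "\<pi> ` V n \<subseteq> carrier K" for n using scale_carrier by auto
    show "\<one>\<^bsub>K\<^esub> \<in> \<pi> ` V n" for n using scale_one[of n] \<pi>.hom_one by (metis image_eqI)
    show "inv\<^bsub>K\<^esub> v \<in> \<pi> ` V n" if "v \<in> \<pi> ` V n" for v n
      using that scale_carrier scale_inv by (auto simp flip: \<pi>.hom_inv)
    show "v \<otimes>\<^bsub>K\<^esub> w \<in> \<pi> ` V n" if "v \<in> \<pi> ` V (Suc n)" "w \<in> \<pi> ` V (Suc n)" for v w n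
      using that scale_carrier scale_mult by (auto simp flip: \<pi>.hom_mult)
  qed
qed

text \<open>The closure of \<open>\<one>\<close>; dividing by it gives the Hausdorff quotient.\<close>
definition core :: "'a set" where
  "core = (\<Inter>n. V n)"

lemma core_normal: "core \<lhd> G"
proof -
  have "subgroup core G"
  proof (rule subgroupI)
    show "core \<subseteq> carrier G" using scale_subset by (auto simp: core_def)
    show "core \<noteq> {}" using scale_one by (auto simp: core_def)
    show "inv a \<in> core" if "a \<in> core" for a using that scale_inv by (auto simp: core_def)
    show "a \<otimes> b \<in> core" if "a \<in> core" "b \<in> core" for a b
      using that scale_mult by (auto simp: core_def)
  qed
  moreover have "x \<otimes> h \<otimes> inv x \<in> core" if "x \<in> carrier G" "h \<in> core" for x h
    using that scale_conj[OF that(1)] by (fastforce simp: core_def)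
  ultimately show ?thesis by (auto simp: normal_inv_iff)
qed

definition quotient_scale :: "nat \<Rightarrow> 'a set set" where
  "quotient_scale n = (\<lambda>x. core #> x) ` V n"

lemma group_hom_quotient: "group_hom G (G Mod core) (\<lambda>x. core #> x)"
  by (intro group_hom.intro group_hom_axioms.intro is_group normal.factorgroup_is_group
      normal.r_coset_hom_Mod core_normal)

lemma group_scale_quotient: "group_scale (G Mod core) quotient_scale"
  unfolding quotient_scale_def
  by (rule group_scale_image[OF group_hom_quotient]) (auto simp: FactGroup_def RCOSETS_def)

text \<open>
  The index drops by one because the core, although contained in every \<open>V n\<close>, is absorbed only
  at the cost of one multiplication.
\<close>
lemma quotient_scale_iff:
  assumes "x \<in> carrier G"
  shows "core #> x \<in> quotient_scale (Suc n) \<Longrightarrow> x \<in> V n"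
    and "x \<in> V n \<Longrightarrow> core #> x \<in> quotient_scale n"
proof -
  assume "core #> x \<in> quotient_scale (Suc n)"
  then obtain v where v: "v \<in> V (Suc n)" "core #> x = core #> v"
    by (auto simp: quotient_scale_def)
  have "x \<in> core #> v"
    using v(2) rcos_self[OF assms] core_normal normal_imp_subgroup by metis
  then obtain k where "k \<in> core" "x = k \<otimes> v" by (auto simp: r_coset_def)
  then show "x \<in> V n" using v(1) by (auto simp: core_def intro: scale_mult)
qed (auto simp: quotient_scale_def)

lemma quotient_scale_separated: "(\<Inter>n. quotient_scale n) = {\<one>\<^bsub>G Mod core\<^esub>}"
proof -
  interpret Q: group_scale "G Mod core" quotient_scale by (rule group_scale_quotient)
  have "X = core" if X: "X \<in> (\<Inter>n. quotient_scale n)" for X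
  proof -
    obtain x where x: "x \<in> carrier G" "X = core #> x"
      using X scale_subset[of 0] unfolding quotient_scale_def by blast
    then have "x \<in> core" using X quotient_scale_iff(1) by (auto simp: core_def)
    then show ?thesis
      using x core_normal coset_join2 normal_imp_subgroup by metis
  qed
  then show ?thesis using Q.scale_one by (auto simp: FactGroup_def)
qed

end

section \<open>Scales on h-complete groups are complete\<close>

context group_scale
begin

lemma cauchy_carrier: "cauchy x \<Longrightarrow> x i \<in> carrier G"
  by (auto simp: cauchy_def)

lemma cauchyD:
  assumes "cauchy x"
  obtains N where "\<And>i j. i \<ge> N \<Longrightarrow> j \<ge> N \<Longrightarrow> inv (x i) \<otimes> x j \<in> V n"
    "\<And>i j. i \<ge> N \<Longrightarrow> j \<ge> N \<Longrightarrow> x i \<otimes> inv (x j) \<in> V n"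
proof -
  from assms obtain N where "\<forall>i\<ge>N. \<forall>j\<ge>N. inv (x i) \<otimes> x j \<in> V n \<and> x i \<otimes> inv (x j) \<in> V n"
    unfolding cauchy_def by blast
  then show thesis using that[of N] by blast
qed

lemma cauchyI:
  assumes "\<And>i. x i \<in> carrier G"
    and "\<And>n. \<exists>N. \<forall>i\<ge>N. \<forall>j\<ge>N. inv (x i) \<otimes> x j \<in> V n \<and> x i \<otimes> inv (x j) \<in> V n"
  shows "cauchy x"
  using assms unfolding cauchy_def by blast

lemma cauchy_const: "y \<in> carrier G \<Longrightarrow> cauchy (\<lambda>_. y)"
  using scale_one by (intro cauchyI) auto

lemma cauchy_inv:
  assumes x: "cauchy x"
  shows "cauchy (\<lambda>i. inv (x i))"
proof (rule cauchyI)
  fix n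
  obtain N where "\<And>i j. i \<ge> N \<Longrightarrow> j \<ge> N \<Longrightarrow> inv (x i) \<otimes> x j \<in> V n"
    "\<And>i j. i \<ge> N \<Longrightarrow> j \<ge> N \<Longrightarrow> x i \<otimes> inv (x j) \<in> V n"
    using cauchyD[OF x] by metis
  then show "\<exists>N. \<forall>i\<ge>N. \<forall>j\<ge>N. inv (inv (x i)) \<otimes> inv (x j) \<in> V n
      \<and> inv (x i) \<otimes> inv (inv (x j)) \<in> V n"
    using cauchy_carrier[OF x] by (intro exI[of _ N]) auto
qed (use cauchy_carrier[OF x] in simp)

text \<open>
  Conjugation by the members of a Cauchy sequence is equicontinuous: up to an error in a small
  \<open>V (Suc (Suc n))\<close> they are equal to the single element \<open>x N\<close>. This is what makes products
  of Cauchy sequences Cauchy and gives their group a group topology.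
\<close>
lemma cauchy_conj:
  assumes x: "cauchy x"
  obtains m N where "\<And>i v. i \<ge> N \<Longrightarrow> v \<in> V m \<Longrightarrow> x i \<otimes> v \<otimes> inv (x i) \<in> V n"
proof -
  obtain N where N: "\<And>i j. i \<ge> N \<Longrightarrow> j \<ge> N \<Longrightarrow> x i \<otimes> inv (x j) \<in> V (Suc (Suc n))"
    using cauchyD[OF x] by metis
  obtain m where m: "\<forall>v\<in>V m. x N \<otimes> v \<otimes> inv (x N) \<in> V (Suc (Suc n))"
    using scale_conj cauchy_carrier[OF x] by blast
  have "x i \<otimes> v \<otimes> inv (x i) \<in> V n" if i: "i \<ge> N" and v: "v \<in> V m" for i v
  proof -
    have "(x i \<otimes> inv (x N)) \<otimes> (x N \<otimes> v \<otimes> inv (x N)) \<in> V (Suc n)"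
      using N[OF i order_refl] m v by (blast intro: scale_mult)
    moreover have "x i \<otimes> inv (x N) \<in> V (Suc n)"
      using N[OF i order_refl] by (rule scale_le) simp
    ultimately have "(x i \<otimes> inv (x N)) \<otimes> (x N \<otimes> v \<otimes> inv (x N)) \<otimes> inv (x i \<otimes> inv (x N)) \<in> V n"
      by (rule scale_divide(2))
    then show ?thesis
      using cauchy_carrier[OF x] scale_carrier[OF v]
      by (simp add: m_assoc inv_mult_group cancel_inv)
  qed
  then show thesis by (rule that)
qed

lemma cauchy_mult:
  assumes x: "cauchy x" and y: "cauchy y"
  shows "cauchy (\<lambda>i. x i \<otimes> y i)"
proof (rule cauchyI)
  fix n
  note carrier = cauchy_carrier[OF x] cauchy_carrier[OF y]
  obtain m M where m: "\<And>i v. i \<ge> M \<Longrightarrow> v \<in> V m \<Longrightarrow> x i \<otimes> v \<otimes> inv (x i) \<in> V (Suc n)"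
    using cauchy_conj[OF x] by metis
  obtain l L where l: "\<And>i v. i \<ge> L \<Longrightarrow> v \<in> V l \<Longrightarrow>
      inv (y i) \<otimes> v \<otimes> inv (inv (y i)) \<in> V (Suc n)"
    using cauchy_conj[OF cauchy_inv[OF y]] by metis
  let ?k = "max (Suc n) (max l m)"
  have le: "v \<in> V (Suc n)" "v \<in> V l" "v \<in> V m" if "v \<in> V ?k" for v
    using that by (rule scale_le; simp)+
  obtain N where N: "\<And>i j. i \<ge> N \<Longrightarrow> j \<ge> N \<Longrightarrow> inv (x i) \<otimes> x j \<in> V ?k"
    "\<And>i j. i \<ge> N \<Longrightarrow> j \<ge> N \<Longrightarrow> x i \<otimes> inv (x j) \<in> V ?k"
    using cauchyD[OF x, of ?k] by metis
  obtain K where K: "\<And>i j. i \<ge> K \<Longrightarrow> j \<ge> K \<Longrightarrow> inv (y i) \<otimes> y j \<in> V ?k"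
    "\<And>i j. i \<ge> K \<Longrightarrow> j \<ge> K \<Longrightarrow> y i \<otimes> inv (y j) \<in> V ?k"
    using cauchyD[OF y, of ?k] by metis
  let ?N = "max (max M L) (max N K)"
  have "inv (x i \<otimes> y i) \<otimes> (x j \<otimes> y j) \<in> V n" "(x i \<otimes> y i) \<otimes> inv (x j \<otimes> y j) \<in> V n"
    if i: "i \<ge> ?N" and j: "j \<ge> ?N" for i j
  proof -
    have "(inv (y i) \<otimes> (inv (x i) \<otimes> x j) \<otimes> inv (inv (y i))) \<otimes> (inv (y i) \<otimes> y j) \<in> V n"
      by (rule scale_mult[OF l[OF _ le(2)[OF N(1)]] le(1)[OF K(1)]]) (use i j in auto)
    then show "inv (x i \<otimes> y i) \<otimes> (x j \<otimes> y j) \<in> V n"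
      using carrier by (simp add: m_assoc inv_mult_group cancel_inv)
    have "(x i \<otimes> (y i \<otimes> inv (y j)) \<otimes> inv (x i)) \<otimes> (x i \<otimes> inv (x j)) \<in> V n"
      by (rule scale_mult[OF m[OF _ le(3)[OF K(2)]] le(1)[OF N(2)]]) (use i j in auto)
    then show "(x i \<otimes> y i) \<otimes> inv (x j \<otimes> y j) \<in> V n"
      using carrier by (simp add: m_assoc inv_mult_group cancel_inv)
  qed
  then show "\<exists>N. \<forall>i\<ge>N. \<forall>j\<ge>N. inv (x i \<otimes> y i) \<otimes> (x j \<otimes> y j) \<in> V n
      \<and> x i \<otimes> y i \<otimes> inv (x j \<otimes> y j) \<in> V n"
    by blast
qed (use cauchy_carrier[OF x] cauchy_carrier[OF y] in simp)

definition cauchy_group :: "(nat \<Rightarrow> 'a) monoid" where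
  "cauchy_group = \<lparr>carrier = Collect cauchy, mult = \<lambda>x y i. x i \<otimes> y i, one = \<lambda>_. \<one>\<rparr>"

lemma group_cauchy_group: "group cauchy_group"
proof (rule groupI)
  fix x assume "x \<in> carrier cauchy_group"
  then have x: "cauchy x" by (simp add: cauchy_group_def)
  show "\<exists>y\<in>carrier cauchy_group. y \<otimes>\<^bsub>cauchy_group\<^esub> x = \<one>\<^bsub>cauchy_group\<^esub>"
    using cauchy_inv[OF x] cauchy_carrier[OF x]
    by (intro bexI[of _ "\<lambda>i. inv (x i)"]) (auto simp: cauchy_group_def)
qed (auto simp: cauchy_group_def cauchy_carrier cauchy_mult cauchy_const m_assoc)

lemma inv_cauchy_group:
  assumes "cauchy x"
  shows "inv\<^bsub>cauchy_group\<^esub> x = (\<lambda>i. inv (x i))"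
  by (rule group.inv_equality[OF group_cauchy_group])
    (use assms in \<open>auto simp: cauchy_group_def cauchy_carrier cauchy_inv\<close>)

text \<open>
  The core of this scale consists of the null sequences, so the Hausdorff quotient of the Cauchy
  group is the completion of the Hausdorff quotient of \<open>G\<close>.
\<close>
definition tail_scale :: "nat \<Rightarrow> (nat \<Rightarrow> 'a) set" where
  "tail_scale n = {x. cauchy x \<and> (\<exists>N. \<forall>i\<ge>N. x i \<in> V n)}"

lemma group_scale_cauchy_group: "group_scale cauchy_group tail_scale"
proof (intro group_scale.intro group_cauchy_group group_scale_axioms.intro)
  fix x n assume "x \<in> carrier cauchy_group"
  then have x: "cauchy x" by (simp add: cauchy_group_def)
  obtain m N where m: "\<And>i v. i \<ge> N \<Longrightarrow> v \<in> V m \<Longrightarrow> x i \<otimes> v \<otimes> inv (x i) \<in> V n"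
    using cauchy_conj[OF x] by metis
  have "x \<otimes>\<^bsub>cauchy_group\<^esub> v \<otimes>\<^bsub>cauchy_group\<^esub> inv\<^bsub>cauchy_group\<^esub> x \<in> tail_scale n"
    if v: "v \<in> tail_scale m" for v
  proof -
    obtain M where M: "\<And>i. i \<ge> M \<Longrightarrow> v i \<in> V m" and "cauchy v"
      using v by (auto simp: tail_scale_def)
    then have "cauchy (\<lambda>i. x i \<otimes> v i \<otimes> inv (x i))"
      using x by (intro cauchy_mult cauchy_inv)
    moreover have "\<forall>i\<ge>max M N. x i \<otimes> v i \<otimes> inv (x i) \<in> V n"
      using m M by simp
    ultimately have "(\<lambda>i. x i \<otimes> v i \<otimes> inv (x i)) \<in> tail_scale n"
      unfolding tail_scale_def by blast
    then show ?thesis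
      unfolding inv_cauchy_group[OF x] by (simp add: cauchy_group_def)
  qed
  then show "\<exists>m. \<forall>v\<in>tail_scale m.
      x \<otimes>\<^bsub>cauchy_group\<^esub> v \<otimes>\<^bsub>cauchy_group\<^esub> inv\<^bsub>cauchy_group\<^esub> x \<in> tail_scale n"
    by blast
next
  fix v w n assume "v \<in> tail_scale (Suc n)" "w \<in> tail_scale (Suc n)"
  then obtain M N where "\<And>i. i \<ge> M \<Longrightarrow> v i \<in> V (Suc n)" "\<And>i. i \<ge> N \<Longrightarrow> w i \<in> V (Suc n)"
    and "cauchy v" "cauchy w"
    by (auto simp: tail_scale_def)
  then have "\<forall>i\<ge>max M N. v i \<otimes> w i \<in> V n" "cauchy (\<lambda>i. v i \<otimes> w i)"
    by (auto intro: scale_mult cauchy_mult)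
  then have "(\<lambda>i. v i \<otimes> w i) \<in> tail_scale n"
    unfolding tail_scale_def by blast
  then show "v \<otimes>\<^bsub>cauchy_group\<^esub> w \<in> tail_scale n"
    by (simp add: cauchy_group_def)
next
  show "inv\<^bsub>cauchy_group\<^esub> v \<in> tail_scale n" if "v \<in> tail_scale n" for v n
    using that by (auto simp: tail_scale_def inv_cauchy_group cauchy_inv intro: scale_inv)
qed (auto simp: tail_scale_def cauchy_group_def cauchy_const scale_one)

text \<open>
  Constant sequences map \<open>G\<close> continuously onto a dense subgroup of the completion. By
  h-completeness the image is closed, so the class of every Cauchy sequence \<open>x\<close> is that of a
  constant sequence \<open>y\<close>, and \<open>y\<close> is a limit of \<open>x\<close>.
\<close>
theorem scale_complete_if_h_complete:
  assumes T: "topological_group G T" and hc: "h_complete G T"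
    and nbhd: "\<And>n. \<exists>S. openin T S \<and> \<one> \<in> S \<and> S \<subseteq> V n"
  shows scale_complete
  unfolding scale_complete_def
proof (intro allI impI)
  fix x assume x: "cauchy x"
  interpret C: group_scale cauchy_group tail_scale by (rule group_scale_cauchy_group)
  define L where "L = cauchy_group Mod C.core"
  interpret Q: group_scale L C.quotient_scale
    unfolding L_def by (rule C.group_scale_quotient)
  interpret \<pi>: group_hom cauchy_group L "\<lambda>x. C.core #>\<^bsub>cauchy_group\<^esub> x"
    unfolding L_def by (rule C.group_hom_quotient)
  define \<phi> where "\<phi> y = C.core #>\<^bsub>cauchy_group\<^esub> (\<lambda>_. y)" for y
  have const: "(\<lambda>_. y) \<in> carrier cauchy_group" if "y \<in> carrier G" for y
    using that by (simp add: cauchy_group_def cauchy_const)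
  have L: "topological_group L Q.scale_topology"
    using Q.topological_group_scale_topology C.quotient_scale_separated unfolding L_def by blast
  have hom: "\<phi> \<in> hom G L"
  proof (rule homI)
    fix a b assume ab: "a \<in> carrier G" "b \<in> carrier G"
    have "(\<lambda>_. a \<otimes> b) = (\<lambda>_. a) \<otimes>\<^bsub>cauchy_group\<^esub> (\<lambda>_. b)"
      by (simp add: cauchy_group_def)
    then show "\<phi> (a \<otimes> b) = \<phi> a \<otimes>\<^bsub>L\<^esub> \<phi> b"
      unfolding \<phi>_def using \<pi>.hom_mult[OF const const] ab by simp
  qed (simp add: \<phi>_def const)
  have "continuous_map T Q.scale_topology \<phi>"
  proof (rule Q.continuous_map_scale_topology[OF T hom])
    fix n
    obtain S where S: "openin T S" "\<one> \<in> S" "S \<subseteq> V n" using nbhd by blast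
    have "\<phi> y \<in> C.quotient_scale n" if "y \<in> V n" for y
      unfolding \<phi>_def using that scale_carrier[OF that]
      by (intro C.quotient_scale_iff(2) const) (auto simp: tail_scale_def cauchy_const)
    then show "\<exists>S. openin T S \<and> \<one> \<in> S \<and> \<phi> ` S \<subseteq> C.quotient_scale n"
      using S by blast
  qed
  then have closed: "closedin Q.scale_topology (\<phi> ` carrier G)"
    by (rule h_complete_closed_image[OF T hc L hom])
  define X where "X = C.core #>\<^bsub>cauchy_group\<^esub> x"
  have xC: "x \<in> carrier cauchy_group" using x by (simp add: cauchy_group_def)
  have XL: "X \<in> carrier L" unfolding X_def using xC by (rule \<pi>.hom_closed)
  \<comment> \<open>The difference between \<open>x\<close> and the constant sequence \<open>y\<close>.\<close>
  define w where "w y = inv\<^bsub>cauchy_group\<^esub> x \<otimes>\<^bsub>cauchy_group\<^esub> (\<lambda>_. y)" for y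
  have w_eq: "w y = (\<lambda>i. inv (x i) \<otimes> y)" for y
    using inv_cauchy_group[OF x] by (simp add: w_def cauchy_group_def)
  have wC: "w y \<in> carrier cauchy_group" if "y \<in> carrier G" for y
    unfolding w_def using xC const[OF that] by simp
  \<comment> \<open>Otherwise a whole neighbourhood of \<open>X\<close> misses the image; but it contains the classes of the
    constant sequences \<open>x N\<close> for large \<open>N\<close>.\<close>
  have "X \<in> \<phi> ` carrier G"
  proof (rule ccontr)
    assume "X \<notin> \<phi> ` carrier G"
    then have "X \<in> carrier L - \<phi> ` carrier G" using XL by blast
    moreover have "openin Q.scale_topology (carrier L - \<phi> ` carrier G)"
      using closed by (simp add: closedin_def Q.topspace_scale_topology)
    ultimately obtain n where n: "\<forall>v\<in>C.quotient_scale n. X \<otimes>\<^bsub>L\<^esub> v \<notin> \<phi> ` carrier G"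
      unfolding Q.openin_scale_topology by (meson DiffD2)
    obtain N where N: "\<And>i. i \<ge> N \<Longrightarrow> inv (x i) \<otimes> x N \<in> V n"
      using cauchyD[OF x] by (metis order_refl)
    have xN: "x N \<in> carrier G" using cauchy_carrier[OF x] .
    have "w (x N) \<in> tail_scale n"
      using N wC[OF xN] by (auto simp: tail_scale_def w_eq cauchy_group_def)
    then have "C.core #>\<^bsub>cauchy_group\<^esub> w (x N) \<in> C.quotient_scale n"
      using wC[OF xN] by (intro C.quotient_scale_iff(2))
    moreover have "X \<otimes>\<^bsub>L\<^esub> (C.core #>\<^bsub>cauchy_group\<^esub> w (x N)) = \<phi> (x N)"
      unfolding X_def \<phi>_def \<pi>.hom_mult[OF xC wC[OF xN], symmetric]
      using xC const[OF xN] by (simp add: w_def C.cancel_inv)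
    ultimately show False using n xN by (metis imageI)
  qed
  then obtain y where y: "y \<in> carrier G" "X = \<phi> y" by blast
  have "\<exists>N. \<forall>i\<ge>N. inv (x i) \<otimes> y \<in> V n" for n
  proof -
    have "C.core #>\<^bsub>cauchy_group\<^esub> w y = \<one>\<^bsub>L\<^esub>"
      unfolding w_def using y xC const[OF y(1)]
      by (simp add: X_def \<phi>_def \<pi>.hom_mult)
    then have "C.core #>\<^bsub>cauchy_group\<^esub> w y \<in> C.quotient_scale (Suc n)"
      using Q.scale_one by simp
    then have "w y \<in> tail_scale n"
      using wC[OF y(1)] by (intro C.quotient_scale_iff(1))
    then show ?thesis by (simp add: tail_scale_def w_eq)
  qed
  then show "\<exists>y\<in>carrier G. \<forall>n. \<exists>N. \<forall>i\<ge>N. inv (x i) \<otimes> y \<in> V n"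
    using y(1) by blast
qed

end

section \<open>Scales of neighbourhoods in a topological group\<close>

lemma (in group) countable_generate:
  assumes S: "S \<subseteq> carrier G" "countable S"
  shows "countable (generate G S)"
proof -
  let ?A = "S \<union> (\<lambda>x. inv x) ` S"
  define p where "p xs = foldr (\<otimes>) xs \<one>" for xs
  have p_closed: "p xs \<in> carrier G" if "xs \<in> lists ?A" for xs
    using that S(1) by (induction xs) (auto simp: p_def)
  have p_append: "p (xs @ ys) = p xs \<otimes> p ys" if "xs \<in> lists ?A" "ys \<in> lists ?A" for xs ys
    using that
  proof (induction xs)
    case Nil
    then show ?case using p_closed[of ys] by (simp add: p_def)
  next
    case (Cons x xs)
    then have "x \<in> carrier G" "xs \<in> lists ?A" using S(1) by auto
    then show ?case
      using Cons p_closed[of xs] p_closed[of ys] by (simp add: p_def m_assoc)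
  qed
  have "x \<in> p ` lists ?A" if "x \<in> generate G S" for x
    using that
  proof (induction rule: generate.induct)
    case one
    then show ?case by (intro image_eqI[of _ _ "[]"]) (auto simp: p_def)
  next
    case (incl h)
    then show ?case using S(1) by (intro image_eqI[of _ _ "[h]"]) (auto simp: p_def)
  next
    case (inv h)
    then show ?case using S(1) by (intro image_eqI[of _ _ "[inv h]"]) (auto simp: p_def)
  next
    case (eng h1 h2)
    then obtain xs ys where "xs \<in> lists ?A" "ys \<in> lists ?A" "h1 = p xs" "h2 = p ys"
      by blast
    then show ?case by (intro image_eqI[of _ _ "xs @ ys"]) (simp_all add: p_append)
  qed
  moreover have "countable (p ` lists ?A)"
    using S(2) by (intro countable_image countable_lists) auto
  ultimately show ?thesis by (meson countable_subset subsetI)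
qed

lemma (in group_scale) group_scale_subgroup:
  assumes K: "subgroup K G"
  shows "group_scale (G\<lparr>carrier := K\<rparr>) (\<lambda>n. V n \<inter> K)"
proof (intro group_scale.intro group_scale_axioms.intro)
  show "group (G\<lparr>carrier := K\<rparr>)" using K subgroup.subgroup_is_group is_group by blast
  note inv_K = m_inv_consistent[OF K]
  show "V n \<inter> K \<subseteq> carrier (G\<lparr>carrier := K\<rparr>)" for n by simp
  show "\<one>\<^bsub>G\<lparr>carrier := K\<rparr>\<^esub> \<in> V n \<inter> K" for n
    using scale_one subgroup.one_closed[OF K] by simp
  show "inv\<^bsub>G\<lparr>carrier := K\<rparr>\<^esub> v \<in> V n \<inter> K" if "v \<in> V n \<inter> K" for v n
    using that scale_inv subgroup.m_inv_closed[OF K] by (simp add: inv_K)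
  show "v \<otimes>\<^bsub>G\<lparr>carrier := K\<rparr>\<^esub> w \<in> V n \<inter> K" if "v \<in> V (Suc n) \<inter> K" "w \<in> V (Suc n) \<inter> K" for v w n
    using that scale_mult subgroup.m_closed[OF K] by simp
  show "\<exists>m. \<forall>v\<in>V m \<inter> K. x \<otimes>\<^bsub>G\<lparr>carrier := K\<rparr>\<^esub> v \<otimes>\<^bsub>G\<lparr>carrier := K\<rparr>\<^esub> inv\<^bsub>G\<lparr>carrier := K\<rparr>\<^esub> x \<in> V n \<inter> K"
    if "x \<in> carrier (G\<lparr>carrier := K\<rparr>)" for x n
  proof -
    have x: "x \<in> K" "x \<in> carrier G" using that subgroup.subset[OF K] by auto
    obtain m where "\<forall>v\<in>V m. x \<otimes> v \<otimes> inv x \<in> V n" using scale_conj[OF x(2)] by blast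
    then show ?thesis
      using x subgroup.m_closed[OF K] subgroup.m_inv_closed[OF K]
      by (intro exI[of _ m]) (auto simp: inv_K)
  qed
qed

context topological_group
begin

lemma topological_group_subgroup:
  assumes K: "subgroup K G"
  shows "topological_group (G\<lparr>carrier := K\<rparr>) (subtopology T K)"
proof (intro topological_group.intro topological_group_axioms.intro)
  show "group (G\<lparr>carrier := K\<rparr>)" using K subgroup.subgroup_is_group is_group by blast
  show "topspace (subtopology T K) = carrier (G\<lparr>carrier := K\<rparr>)"
    using subgroup.subset[OF K] topspace_eq by auto
  show "Hausdorff_space (subtopology T K)" using Hausdorff Hausdorff_space_subtopology by blast
  have "continuous_map (prod_topology (subtopology T K) (subtopology T K)) T (\<lambda>(x, y). x \<otimes> y)"
    using continuous_mult by (simp flip: subtopology_Times add: continuous_map_from_subtopology)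
  then show "continuous_map (prod_topology (subtopology T K) (subtopology T K)) (subtopology T K)
      (\<lambda>(x, y). x \<otimes>\<^bsub>G\<lparr>carrier := K\<rparr>\<^esub> y)"
    using subgroup.m_closed[OF K] by (auto simp: continuous_map_in_subtopology)
  have "continuous_map (subtopology T K) T (\<lambda>x. inv x)"
    using continuous_inv by (rule continuous_map_from_subtopology)
  then have "continuous_map (subtopology T K) (subtopology T K) (\<lambda>x. inv x)"
    using subgroup.m_inv_closed[OF K] by (auto simp: continuous_map_in_subtopology)
  then show "continuous_map (subtopology T K) (subtopology T K) (\<lambda>x. inv\<^bsub>G\<lparr>carrier := K\<rparr>\<^esub> x)"
    by (rule continuous_map_eq) (simp add: m_inv_consistent[OF K])
qed

lemma openin_conjugate:
  assumes S: "openin T S" and a: "a \<in> carrier G"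
  shows "openin T {x \<in> carrier G. a \<otimes> x \<otimes> inv a \<in> S}"
proof -
  have "continuous_map T T ((\<lambda>x. x \<otimes> inv a) \<circ> (\<lambda>x. a \<otimes> x))"
    using a by (intro continuous_map_compose[OF continuous_map_translations(1)
        continuous_map_translations(2)]) auto
  from openin_continuous_map_preimage[OF this S] show ?thesis
    by (simp add: topspace_eq)
qed

lemma smaller_neighbourhood:
  assumes A: "openin T A" "\<one> \<in> A" and F: "finite F" "F \<subseteq> carrier G"
  shows "\<exists>B. openin T B \<and> \<one> \<in> B \<and> (\<forall>v\<in>B. inv v \<in> B) \<and> (\<forall>v\<in>B. \<forall>w\<in>B. v \<otimes> w \<in> A)
    \<and> (\<forall>a\<in>F. \<forall>v\<in>B. a \<otimes> v \<otimes> inv a \<in> A)"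
proof -
  have sub: "x \<in> carrier G" if "openin T S" "x \<in> S" for S x
    using that openin_subset topspace_eq by blast
  have "openin (prod_topology T T)
      {z \<in> topspace (prod_topology T T). (case z of (x, y) \<Rightarrow> x \<otimes> y) \<in> A}"
    using openin_continuous_map_preimage[OF continuous_mult A(1)] .
  moreover have "(\<one>, \<one>) \<in> {z \<in> topspace (prod_topology T T). (case z of (x, y) \<Rightarrow> x \<otimes> y) \<in> A}"
    using A(2) by (simp add: topspace_eq)
  ultimately obtain B1 B2 where B: "openin T B1" "openin T B2" "\<one> \<in> B1" "\<one> \<in> B2"
    "B1 \<times> B2 \<subseteq> {z \<in> topspace (prod_topology T T). (case z of (x, y) \<Rightarrow> x \<otimes> y) \<in> A}"
    unfolding openin_prod_topology_alt by meson
  have mult: "v \<otimes> w \<in> A" if "v \<in> B1" "w \<in> B2" for v w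
    using subsetD[OF B(5), of "(v, w)"] that by simp
  define C where "C = {x \<in> carrier G. \<forall>a\<in>F. a \<otimes> x \<otimes> inv a \<in> A}"
  have "openin T C"
    unfolding C_def using F
  proof (induction F)
    case empty
    then show ?case using openin_topspace[of T] by (simp add: topspace_eq)
  next
    case (insert a F)
    have "openin T ({x \<in> carrier G. a \<otimes> x \<otimes> inv a \<in> A} \<inter> {x \<in> carrier G. \<forall>a\<in>F. a \<otimes> x \<otimes> inv a \<in> A})"
      using insert openin_conjugate[OF A(1)] by (intro openin_Int) auto
    then show ?case by (rule back_subst[of "openin T"]) auto
  qed
  moreover have "\<one> \<in> C" using F(2) A(2) by (auto simp: C_def subset_iff)
  ultimately have D: "openin T (B1 \<inter> B2 \<inter> C)" "\<one> \<in> B1 \<inter> B2 \<inter> C"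
    using B by auto
  define B where "B = {x \<in> B1 \<inter> B2 \<inter> C. inv x \<in> B1 \<inter> B2 \<inter> C}"
  have "openin T {x \<in> topspace T. inv x \<in> B1 \<inter> B2 \<inter> C}"
    using openin_continuous_map_preimage[OF continuous_inv D(1)] .
  then have "openin T ((B1 \<inter> B2 \<inter> C) \<inter> {x \<in> topspace T. inv x \<in> B1 \<inter> B2 \<inter> C})"
    using D(1) by (rule openin_Int[rotated])
  then have "openin T B"
    by (rule back_subst[of "openin T"]) (use sub[OF D(1)] in \<open>auto simp: B_def topspace_eq\<close>)
  moreover have "\<one> \<in> B" using D(2) by (simp add: B_def)
  moreover have "inv v \<in> B" if "v \<in> B" for v
    using that sub[OF D(1)] by (auto simp: B_def)
  ultimately show ?thesis
    using mult by (intro exI[of _ B]) (auto simp: B_def C_def)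
qed

text \<open>
  Only conjugation is missing for a scale. The name follows the strings of neighbourhoods that are
  used in the theory of topological vector spaces.
\<close>
definition neighbourhood_string :: "(nat \<Rightarrow> 'a set) \<Rightarrow> bool" where
  "neighbourhood_string V \<longleftrightarrow> (\<forall>n. openin T (V n) \<and> \<one> \<in> V n \<and> (\<forall>v\<in>V n. inv v \<in> V n) \<and>
    (\<forall>v\<in>V (Suc n). \<forall>w\<in>V (Suc n). v \<otimes> w \<in> V n))"

lemma neighbourhood_stringD:
  assumes "neighbourhood_string V"
  shows "openin T (V n)" "\<one> \<in> V n" "v \<in> V n \<Longrightarrow> inv v \<in> V n"
    "v \<in> V (Suc n) \<Longrightarrow> w \<in> V (Suc n) \<Longrightarrow> v \<otimes> w \<in> V n" "v \<in> V n \<Longrightarrow> v \<in> carrier G"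
  using assms openin_subset[of T "V n"] topspace_eq unfolding neighbourhood_string_def by blast+

lemma group_scale_if_string:
  assumes "neighbourhood_string V"
    and "\<And>x n. x \<in> carrier G \<Longrightarrow> \<exists>m. \<forall>v\<in>V m. x \<otimes> v \<otimes> inv x \<in> V n"
  shows "group_scale G V"
proof (intro group_scale.intro is_group group_scale_axioms.intro)
  show "V n \<subseteq> carrier G" for n using neighbourhood_stringD(5)[OF assms(1)] by blast
qed (fact neighbourhood_stringD(2-4)[OF assms(1)] assms(2))+

text \<open>
  At stage \<open>n\<close> only the finitely many conjugations by \<open>d 0, \<dots>, d n\<close> have to be
  respected, so a neighbourhood that is small enough exists; each \<open>d i\<close> is taken into account
  from stage \<open>i\<close> on.
\<close>
lemma exists_neighbourhood_string:
  fixes d :: "nat \<Rightarrow> 'a"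
  assumes C: "\<And>n. openin T (C n)" "\<And>n. \<one> \<in> C n" and d: "\<And>i. d i \<in> carrier G"
  shows "\<exists>V. neighbourhood_string V \<and> (\<forall>n. V n \<subseteq> C n) \<and>
    (\<forall>n. \<forall>i\<le>n. \<forall>v\<in>V (Suc n). d i \<otimes> v \<otimes> inv (d i) \<in> V n)"
proof -
  define P where "P n A \<longleftrightarrow> openin T A \<and> \<one> \<in> A \<and> A \<subseteq> C n \<and> (\<forall>v\<in>A. inv v \<in> A)" for n A
  define Q where "Q n A B \<longleftrightarrow> (\<forall>v\<in>B. \<forall>w\<in>B. v \<otimes> w \<in> A) \<and>
    (\<forall>i\<le>n. \<forall>v\<in>B. d i \<otimes> v \<otimes> inv (d i) \<in> A)" for n A B
  have small: "\<exists>B. P m B \<and> Q n A B" if A: "openin T A" "\<one> \<in> A" for A m n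
  proof -
    have "openin T (A \<inter> C m)" "\<one> \<in> A \<inter> C m" "finite (d ` {..n})" "d ` {..n} \<subseteq> carrier G"
      using A C d by auto
    from smaller_neighbourhood[OF this]
    obtain B where B: "openin T B" "\<one> \<in> B" "\<forall>v\<in>B. inv v \<in> B" "\<forall>v\<in>B. \<forall>w\<in>B. v \<otimes> w \<in> A \<inter> C m"
      "\<forall>a\<in>d ` {..n}. \<forall>v\<in>B. a \<otimes> v \<otimes> inv a \<in> A \<inter> C m"
      by blast
    have "v \<in> C m" if v: "v \<in> B" for v
    proof -
      have "v \<otimes> \<one> \<in> C m" using B(2,4) v by blast
      then show ?thesis using openin_subset[OF B(1)] v by (auto simp: topspace_eq)
    qed
    then have "P m B \<and> Q n A B"
      using B by (auto simp: P_def Q_def)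
    then show ?thesis by blast
  qed
  have "\<exists>V. \<forall>n. P n (V n) \<and> Q n (V n) (V (Suc n))"
  proof (rule dependent_nat_choice)
    show "\<exists>A. P 0 A" using small[OF C] by blast
    show "\<exists>B. P (Suc n) B \<and> Q n A B" if "P n A" for A n
      using small that by (auto simp: P_def)
  qed
  then obtain V where V: "\<And>n. P n (V n)" "\<And>n. Q n (V n) (V (Suc n))" by blast
  have "neighbourhood_string V"
    unfolding neighbourhood_string_def using V by (simp add: P_def Q_def)
  moreover have "\<forall>n. V n \<subseteq> C n" using V(1) by (simp add: P_def)
  moreover have "\<forall>n. \<forall>i\<le>n. \<forall>v\<in>V (Suc n). d i \<otimes> v \<otimes> inv (d i) \<in> V n"
    using V(2) by (simp add: Q_def)
  ultimately show ?thesis by blast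
qed

text \<open>Once the string is a neighbourhood base of \<open>\<one>\<close>, its compatibility with conjugation is
  just the continuity of conjugation.
\<close>
lemma fundamental_scale:
  assumes "first_countable T"
  obtains B where "group_scale G B" "\<And>n. openin T (B n)"
    "\<And>S. openin T S \<Longrightarrow> \<one> \<in> S \<Longrightarrow> \<exists>n. B n \<subseteq> S"
proof -
  have "\<one> \<in> topspace T" by (simp add: topspace_eq)
  with assms obtain \<B> where \<B>: "countable \<B>" "\<And>S. S \<in> \<B> \<Longrightarrow> openin T S"
    "\<And>S. openin T S \<Longrightarrow> \<one> \<in> S \<Longrightarrow> \<exists>B\<in>\<B>. \<one> \<in> B \<and> B \<subseteq> S"
    unfolding first_countable_def by metis
  let ?\<B> = "{B \<in> \<B>. \<one> \<in> B}"
  have ne: "?\<B> \<noteq> {}" using \<B>(3)[OF openin_topspace] \<open>\<one> \<in> topspace T\<close> by blast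
  have count: "countable ?\<B>" using \<B>(1) by (rule countable_subset[rotated]) auto
  define C where "C = from_nat_into ?\<B>"
  have C: "openin T (C n)" "\<one> \<in> C n" for n
    using from_nat_into[OF ne, of n] \<B>(2) by (auto simp: C_def)
  obtain B where B: "neighbourhood_string B" "\<And>n. B n \<subseteq> C n"
    using exists_neighbourhood_string[of C "\<lambda>_. \<one>", OF C one_closed] by blast
  note string = neighbourhood_stringD[OF B(1)]
  have base: "\<exists>n. B n \<subseteq> S" if S: "openin T S" "\<one> \<in> S" for S
  proof -
    obtain A where "A \<in> ?\<B>" "A \<subseteq> S" using \<B>(3)[OF S] by blast
    moreover from this obtain n where "C n = A"
      using from_nat_into_surj[OF count] unfolding C_def by metis
    ultimately show ?thesis using B(2) by blast
  qed
  have "group_scale G B"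
  proof (rule group_scale_if_string[OF B(1)])
    fix x n assume x: "x \<in> carrier G"
    have "\<exists>m. B m \<subseteq> {v \<in> carrier G. x \<otimes> v \<otimes> inv x \<in> B n}"
      using x string(2) by (intro base openin_conjugate[OF string(1) x]) simp
    then show "\<exists>m. \<forall>v\<in>B m. x \<otimes> v \<otimes> inv x \<in> B n" by blast
  qed
  then show thesis using string(1) base by (rule that)
qed

text \<open>
  Conjugation by the members of a dense sequence suffices: every \<open>x\<close> is \<open>u \<otimes> d i\<close>
  for some \<open>u\<close> in \<open>V (Suc (Suc n))\<close>, and conjugation by \<open>u\<close> costs two indices.
\<close>
lemma separable_scale:
  fixes d :: "nat \<Rightarrow> 'a"
  assumes C: "\<And>n. openin T (C n)" "\<And>n. \<one> \<in> C n"
    and d: "\<And>i. d i \<in> carrier G" and dense: "T closure_of (range d) = carrier G"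
  obtains V where "group_scale G V" "\<And>n. openin T (V n)" "\<And>n. V n \<subseteq> C n"
    "\<And>n x. x \<in> carrier G \<Longrightarrow> \<exists>i. inv (d i) \<otimes> x \<in> V n"
proof -
  obtain V where V: "neighbourhood_string V" "\<And>n. V n \<subseteq> C n"
    and conj: "\<And>n i v. i \<le> n \<Longrightarrow> v \<in> V (Suc n) \<Longrightarrow> d i \<otimes> v \<otimes> inv (d i) \<in> V n"
    using exists_neighbourhood_string[of C d, OF C d] by blast
  note string = neighbourhood_stringD[OF V(1)]
  have hit: "\<exists>i. d i \<in> S" if "openin T S" "x \<in> S" for S x
  proof -
    have "x \<in> T closure_of (range d)"
      using that dense openin_subset topspace_eq by blast
    then show ?thesis using that unfolding in_closure_of by blast
  qed
  have cover: "\<exists>i. inv (d i) \<otimes> x \<in> V n" if x: "x \<in> carrier G" for x n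
  proof -
    obtain i where "inv x \<otimes> d i \<in> V n"
      using hit[OF openin_translate[OF string(1)[of n] x], of x] x string(2) by auto
    then have "inv (inv x \<otimes> d i) \<in> V n" by (rule string(3))
    then show ?thesis using x d by (auto simp: inv_mult_group)
  qed
  have Suc: "V (Suc n) \<subseteq> V n" for n
    using string(4)[OF _ string(2)] string(5) by fastforce
  have anti: "V n \<subseteq> V m" if "m \<le> n" for m n
    using that Suc by (rule lift_Suc_antimono_le[rotated])
  have "group_scale G V"
  proof (rule group_scale_if_string[OF V(1)])
    fix x n assume x: "x \<in> carrier G"
    have "openin T {y \<in> carrier G. y \<otimes> inv x \<in> V (Suc (Suc n))}"
      using openin_continuous_map_preimage[OF continuous_map_translations(2) string(1)] x
      by (simp add: topspace_eq)
    from hit[OF this, of x] obtain i where i: "d i \<otimes> inv x \<in> V (Suc (Suc n))"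
      using x string(2) by auto
    define u where "u = inv (d i \<otimes> inv x)"
    have u: "u \<in> V (Suc (Suc n))" unfolding u_def using i by (rule string(3))
    let ?m = "max i (Suc (Suc n))"
    have "x \<otimes> v \<otimes> inv x \<in> V n" if v: "v \<in> V (Suc ?m)" for v
    proof -
      have "d i \<otimes> v \<otimes> inv (d i) \<in> V (Suc (Suc n))"
        using conj[of i ?m v] v anti[of "Suc (Suc n)" ?m] by auto
      then have "(u \<otimes> (d i \<otimes> v \<otimes> inv (d i))) \<otimes> inv u \<in> V n"
        using u Suc by (blast intro: string(3,4))
      then show ?thesis
        using x d string(5)[OF v] by (simp add: u_def inv_mult_group m_assoc cancel_inv)
    qed
    then show "\<exists>m. \<forall>v\<in>V m. x \<otimes> v \<otimes> inv x \<in> V n" by blast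
  qed
  then show thesis using string(1) V(2) cover by (rule that)
qed

end

section \<open>Homomorphisms of hereditarily h-complete groups\<close>

lemma (in group_scale) group_scale_vimage:
  assumes "group_hom K G \<phi>"
  shows "group_scale K (\<lambda>n. {x \<in> carrier K. \<phi> x \<in> V n})"
proof -
  interpret \<phi>: group_hom K G \<phi> by fact
  show ?thesis
  proof unfold_locales
    fix x n assume x: "x \<in> carrier K"
    then obtain m where "\<forall>v\<in>V m. \<phi> x \<otimes> v \<otimes> inv (\<phi> x) \<in> V n"
      using scale_conj[of "\<phi> x" n] by auto
    then show "\<exists>m. \<forall>v\<in>{x \<in> carrier K. \<phi> x \<in> V m}.
        x \<otimes>\<^bsub>K\<^esub> v \<otimes>\<^bsub>K\<^esub> inv\<^bsub>K\<^esub> x \<in> {x \<in> carrier K. \<phi> x \<in> V n}"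
      using x by (intro exI[of _ m]) auto
  qed (auto simp: scale_one scale_inv scale_mult)
qed

context topological_group
begin

lemma one_point_intersection:
  assumes B: "\<And>S. openin T S \<Longrightarrow> \<one> \<in> S \<Longrightarrow> \<exists>n. B n \<subseteq> S"
    and x: "x \<in> carrier G" "\<And>n. x \<in> B n"
  shows "x = \<one>"
proof (rule ccontr)
  assume "x \<noteq> \<one>"
  then obtain S where "openin T S" "\<one> \<in> S" "x \<notin> S"
    using Hausdorff_imp_t1_space[OF Hausdorff] x(1) unfolding t1_space_def topspace_eq
    by (metis one_closed)
  then show False using B x(2) by blast
qed

text \<open>
  The reduction to separable subgroups. If the assertion fails, it fails along a sequence
  \<open>g\<close>, and then also in the closed subgroup \<open>K\<close> generated by \<open>g\<close>. There the open
  mapping theorem applies to the scale \<open>U\<close> and a finer scale that starts inside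
  \<open>W\<close>.
\<close>
lemma scale_covers_neighbourhood:
  assumes hhc: "hereditarily_h_complete G T"
    and scale: "group_scale G U" and U: "\<And>n. openin T (U n)"
    and W: "openin T W" "\<one> \<in> W"
  shows "\<exists>m. \<forall>h\<in>U m. \<exists>w\<in>W. inv w \<otimes> h \<in> (\<Inter>k. U k)"
proof (rule ccontr)
  interpret U: group_scale G U by (rule scale)
  define N where "N = (\<Inter>k. U k)"
  assume "\<not> ?thesis"
  then have "\<forall>m. \<exists>h. h \<in> U m \<and> (\<forall>w\<in>W. inv w \<otimes> h \<notin> N)"
    unfolding N_def by meson
  then obtain g where g: "\<And>m. g m \<in> U m" "\<And>m w. w \<in> W \<Longrightarrow> inv w \<otimes> g m \<notin> N"
    by metis
  have g_carrier: "range g \<subseteq> carrier G" using g(1) U.scale_carrier by blast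
  define D where "D = generate G (range g)"
  have D: "subgroup D G" "countable D" "range g \<subseteq> D"
    unfolding D_def using generate_is_subgroup[OF g_carrier] countable_generate[OF g_carrier]
    by (auto intro: generate.incl)
  define K where "K = T closure_of D"
  have K: "subgroup K G" unfolding K_def by (rule subgroup_closure_of[OF D(1)])
  have KG: "K \<subseteq> carrier G" by (rule subgroup.subset[OF K])
  have DK: "D \<subseteq> K"
    unfolding K_def using subgroup.subset[OF D(1)] topspace_eq closure_of_subset by metis
  let ?K = "G\<lparr>carrier := K\<rparr>" and ?T = "subtopology T K"
  have TK: "topological_group ?K ?T" by (rule topological_group_subgroup[OF K])
  interpret K: topological_group ?K ?T by (rule TK)
  have hc: "h_complete ?K ?T"
    using hhc K unfolding hereditarily_h_complete_def K_def by simp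
  define d where "d = from_nat_into D"
  have "D \<noteq> {}" using subgroup.one_closed[OF D(1)] by blast
  then have d: "range d = D" unfolding d_def using D(2) by (rule range_from_nat_into)
  have dK: "d i \<in> carrier ?K" for i using d DK by auto
  have dense: "?T closure_of (range d) = carrier ?K"
    using DK by (simp add: closure_of_subtopology d K_def Int_absorb1)
  have UK: "group_scale ?K (\<lambda>n. U n \<inter> K)" by (rule U.group_scale_subgroup[OF K])
  have U_open: "openin ?T (U n \<inter> K)" for n
    using U by (auto simp: openin_subtopology)
  have WU: "openin ?T (W \<inter> U n \<inter> K)" for n
    using openin_Int[OF W(1) U] by (auto simp: openin_subtopology)
  have one_WU: "\<one>\<^bsub>?K\<^esub> \<in> W \<inter> U n \<inter> K" for n
    using W(2) U.scale_one subgroup.one_closed[OF K] by simp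
  obtain V where V: "group_scale ?K V" "\<And>n. openin ?T (V n)" "\<And>n. V n \<subseteq> W \<inter> U n \<inter> K"
    and cover: "\<And>n x. x \<in> carrier ?K \<Longrightarrow> \<exists>i. inv\<^bsub>?K\<^esub> (d i) \<otimes>\<^bsub>?K\<^esub> x \<in> V n"
    using K.separable_scale[of "\<lambda>n. W \<inter> U n \<inter> K" d, OF WU one_WU dK dense] by metis
  have "V n \<subseteq> U n \<inter> K" for n using V(3) by blast
  then interpret VU: two_scales ?K V "\<lambda>n. U n \<inter> K"
    by (intro two_scales.intro two_scales_axioms.intro V(1) UK)
  have "VU.V.scale_complete"
    by (rule VU.V.scale_complete_if_h_complete[OF TK hc]) (use V(2) VU.V.scale_one in blast)
  moreover have "VU.U.scale_complete"
    by (rule VU.U.scale_complete_if_h_complete[OF TK hc]) (use U_open VU.U.scale_one in blast)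
  ultimately obtain m where
    m: "\<And>h. h \<in> U m \<inter> K \<Longrightarrow> \<exists>v\<in>V 0. inv\<^bsub>?K\<^esub> v \<otimes>\<^bsub>?K\<^esub> h \<in> (\<Inter>k. U k \<inter> K)"
    using VU.open_mapping[OF _ _ dK cover, where n = 0] by blast
  have "g m \<in> U m \<inter> K" using g(1) D(3) DK by blast
  then obtain v where v: "v \<in> V 0" "inv\<^bsub>?K\<^esub> v \<otimes>\<^bsub>?K\<^esub> g m \<in> (\<Inter>k. U k \<inter> K)"
    using m by blast
  then have "v \<in> W" "v \<in> K" using V(3) by blast+
  then have "inv v \<otimes> g m \<in> N"
    using v(2) by (auto simp: N_def m_inv_consistent[OF K])
  then show False using g(2) \<open>v \<in> W\<close> by blast
qed

end

text \<open>
  Applied to the preimages of a neighbourhood base of \<open>H\<close>, whose intersection is the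
  kernel of \<open>f\<close>, the preceding lemma says that \<open>f\<close> maps neighbourhoods of \<open>\<one>\<close> to
  neighbourhoods of \<open>\<one>\<close>.
\<close>
theorem open_map_if_first_countable:
  fixes G :: "('a, 'm) monoid_scheme" and H :: "('b, 'n) monoid_scheme"
  assumes G: "topological_group G TG" and hhc: "hereditarily_h_complete G TG"
    and H: "topological_group H TH" and fc: "first_countable TH"
    and hom: "f \<in> hom G H" and cont: "continuous_map TG TH f"
    and onto: "f ` carrier G = carrier H"
  shows "open_map TG TH f"
  unfolding open_map_def
proof (intro allI impI)
  fix S assume S: "openin TG S"
  interpret G: topological_group G TG by (rule G)
  interpret H: topological_group H TH by (rule H)
  interpret f: group_hom G H f using hom by unfold_locales
  obtain B where B: "group_scale H B" "\<And>n. openin TH (B n)"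
    and base: "\<And>A. openin TH A \<Longrightarrow> \<one>\<^bsub>H\<^esub> \<in> A \<Longrightarrow> \<exists>n. B n \<subseteq> A"
    using H.fundamental_scale[OF fc] by metis
  interpret B: group_scale H B by (rule B(1))
  define U where "U n = {x \<in> carrier G. f x \<in> B n}" for n
  have U: "group_scale G U"
    unfolding U_def by (rule B.group_scale_vimage) unfold_locales
  have U_open: "openin TG (U n)" for n
    using openin_continuous_map_preimage[OF cont B(2)] by (simp add: U_def G.topspace_eq)
  show "openin TH (f ` S)"
  proof (subst openin_subopen, intro ballI)
    fix y assume "y \<in> f ` S"
    then obtain x where x: "x \<in> S" "y = f x" by blast
    have xG: "x \<in> carrier G" using x(1) openin_subset[OF S] G.topspace_eq by blast
    define W where "W = {w \<in> carrier G. x \<otimes>\<^bsub>G\<^esub> w \<in> S}"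
    have W: "openin TG W"
      using openin_continuous_map_preimage[OF G.continuous_map_translations(1)[OF xG] S]
      by (simp add: W_def G.topspace_eq)
    have one_W: "\<one>\<^bsub>G\<^esub> \<in> W" using x xG by (simp add: W_def)
    obtain m where
      m: "\<And>h. h \<in> U m \<Longrightarrow> \<exists>w\<in>W. inv\<^bsub>G\<^esub> w \<otimes>\<^bsub>G\<^esub> h \<in> (\<Inter>k. U k)"
      using G.scale_covers_neighbourhood[OF hhc U U_open W one_W] by metis
    let ?N = "{z \<in> carrier H. inv\<^bsub>H\<^esub> (f x) \<otimes>\<^bsub>H\<^esub> z \<in> B m}"
    have "z \<in> f ` S" if z: "z \<in> carrier H" "inv\<^bsub>H\<^esub> (f x) \<otimes>\<^bsub>H\<^esub> z \<in> B m" for z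
    proof -
      obtain h where h: "h \<in> carrier G" "f h = inv\<^bsub>H\<^esub> (f x) \<otimes>\<^bsub>H\<^esub> z"
        using onto z(1) xG by (metis (no_types, lifting) H.inv_closed H.m_closed f.hom_closed imageE)
      then have "h \<in> U m" using z(2) by (simp add: U_def)
      then obtain w where w: "w \<in> W" "inv\<^bsub>G\<^esub> w \<otimes>\<^bsub>G\<^esub> h \<in> (\<Inter>k. U k)" using m by blast
      have wG: "w \<in> carrier G" "x \<otimes>\<^bsub>G\<^esub> w \<in> S" using w(1) by (auto simp: W_def)
      have "f (inv\<^bsub>G\<^esub> w \<otimes>\<^bsub>G\<^esub> h) = \<one>\<^bsub>H\<^esub>"
        using w(2) wG h(1) by (intro H.one_point_intersection[OF base]) (auto simp: U_def)
      then have "inv\<^bsub>H\<^esub> (f w) \<otimes>\<^bsub>H\<^esub> f h = \<one>\<^bsub>H\<^esub>" using wG h(1) by simp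
      then have "f w \<otimes>\<^bsub>H\<^esub> (inv\<^bsub>H\<^esub> (f w) \<otimes>\<^bsub>H\<^esub> f h) = f w" using wG by simp
      then have "f h = f w" using wG h(1) by (simp add: H.cancel_inv del: f.hom_inv)
      then have "f x \<otimes>\<^bsub>H\<^esub> f w = f x \<otimes>\<^bsub>H\<^esub> (inv\<^bsub>H\<^esub> (f x) \<otimes>\<^bsub>H\<^esub> z)"
        using h(2) by simp
      then have "z = f (x \<otimes>\<^bsub>G\<^esub> w)"
        using z(1) xG wG by (simp add: H.cancel_inv del: f.hom_inv)
      then show ?thesis using wG(2) by blast
    qed
    moreover have "openin TH ?N" using H.openin_translate[OF B(2)] xG by simp
    moreover have "y \<in> ?N" using x(2) xG B.scale_one by simp
    ultimately show "\<exists>A. openin TH A \<and> y \<in> A \<and> A \<subseteq> f ` S" by blast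
  qed
qed

theorem corollary2p4:
  fixes G :: "('a, 'm) monoid_scheme" and TG :: "'a topology"
    and H :: "('b, 'n) monoid_scheme" and TH :: "'b topology"
    and f :: "'a \<Rightarrow> 'b"
  assumes "topological_group G TG"
    and "hereditarily_h_complete G TG"
    and "topological_group H TH"
    and "metrizable_space TH"
    and "f \<in> hom G H"
    and "continuous_map TG TH f"
    and "f ` carrier G = carrier H"
  shows "open_map TG TH f"
  using assms metrizable_imp_first_countable by (blast intro: open_map_if_first_countable)

end
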